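(* Let $d\ge 4$, $b>0$. For each $p\in(0,1)$ it holds that $$\lambda(\alpha)>1\qquad\text{for all } 0\le\alpha<M(p).$$
   Context: $\mathcal L$ is the directed graph with vertex set $\mathbb Z^d\times\mathbb Z_+$ ($\mathbb Z_+=\{0,1,2,\dots\}$) in which each vertex $v$ has exactly $2d$ outgoing edges, namely to $v\pm e_i+e_{d+1}$ for $1\le i\le d$, where $e_i$ is the $i$-th coordinate vector. $\mathbf 0$ denotes the origin. An oriented path of length $s$ is a sequence $\pi=(\pi_0,\pi_1,\dots,\pi_s)$ of vertices such that there is a directed edge of $\mathcal L$ from $\pi_{i}$ to $\pi_{i+1}$ for $0\le i<s$; we write $|\pi|=s$. The random variables $\{X(v): v\in\mathbb Z^d\times\mathbb Z_+\}$ are i.i.d. with $P\{X(v)=e^b\}=p$, $P\{X(v)=1\}=1-p$. For a path $\pi$ of length $s$, $W(\pi)$ is the number of indices $i$ with $1\le i\le s$ and $X(\pi_i)=e^b$ (the starting vertex $\pi_0$ is not counted). For real $\alpha\ge0$, $N_s(\alpha)$ is the number of oriented paths $\pi$ of length $s$ with $\pi_0=\mathbf 0$ and $W(\pi)\ge\alpha s$. $M(p):=\lim_{s\to\infty}\max_{\pi_0=\mathbf 0,|\pi|=s}\frac1s W(\pi)$, the maximum being over oriented paths of length $s$ starting at $\mathbf 0$; this limit exists almost surely and is almost surely a constant. $\lambda(\alpha)=\lambda(\alpha,p)$ denotes the almost sure constant value of $\lim_{t\to\infty}[N_t(\alpha)]^{1/t}$, which exists whenever $\alpha\ge0$, $\alpha\ne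 M(p)$. *)

theory Defs
  imports "HOL-Probability.Probability"
begin

type_synonym 'd vertex = "(int ^ 'd) \<times> nat"

definition edge :: "'d::finite vertex \<Rightarrow> 'd vertex \<Rightarrow> bool" where
  "edge v w \<longleftrightarrow>
     (\<exists>i. fst w = fst v + axis i 1 \<or> fst w = fst v - axis i 1) \<and> snd w = snd v + 1"

text \<open>A path of length \<open>s\<close> is a list of \<open>s + 1\<close> vertices.\<close>

definition oriented_path :: "nat \<Rightarrow> 'd::finite vertex list \<Rightarrow> bool" where
  "oriented_path s \<pi> \<longleftrightarrow> length \<pi> = s + 1 \<and> (\<forall>i<s. edge (\<pi> ! i) (\<pi> ! (i + 1)))"

definition origin_paths :: "nat \<Rightarrow> 'd::finite vertex list set" where
  "origin_paths s = {\<pi>. oriented_path s \<pi> \<and> \<pi> ! 0 = (0, 0)}"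

text \<open>Below, \<open>x\<close> is a single realisation of the environment, i.e. \<open>x v = X v \<omega>\<close>.\<close>

definition path_weight :: "real \<Rightarrow> ('d::finite vertex \<Rightarrow> real) \<Rightarrow> 'd vertex list \<Rightarrow> nat" where
  "path_weight b x \<pi> = card {i. 1 \<le> i \<and> i < length \<pi> \<and> x (\<pi> ! i) = exp b}"

definition num_paths ::
    "real \<Rightarrow> ('d::finite vertex \<Rightarrow> real) \<Rightarrow> nat \<Rightarrow> real \<Rightarrow> nat" where
  "num_paths b x s \<alpha> =
     card {\<pi> \<in> origin_paths s. real (path_weight b x \<pi>) \<ge> \<alpha> * real s}"

text \<open>The almost sure constant value of the limit of a sequence of random variables. It is
  unspecified if there is no such constant; over a probability space it is unique if it exists.\<close>

definition as_lim :: "'w measure \<Rightarrow> (nat \<Rightarrow> 'w \<Rightarrow> real) \<Rightarrow> real" where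
  "as_lim P Y = (THE c. AE \<omega> in P. (\<lambda>s. Y s \<omega>) \<longlonglongrightarrow> c)"

definition max_density :: "'w measure \<Rightarrow> real \<Rightarrow> ('d::finite vertex \<Rightarrow> 'w \<Rightarrow> real) \<Rightarrow> real" where
  "max_density P b X =
     as_lim P (\<lambda>s \<omega>. MAX \<pi> \<in> origin_paths s. (1 / real s) * real (path_weight b (\<lambda>v. X v \<omega>) \<pi>))"

definition growth_rate ::
    "'w measure \<Rightarrow> real \<Rightarrow> ('d::finite vertex \<Rightarrow> 'w \<Rightarrow> real) \<Rightarrow> real \<Rightarrow> real" where
  "growth_rate P b X \<alpha> =
     as_lim P (\<lambda>t \<omega>. real (num_paths b (\<lambda>v. X v \<omega>) t \<alpha>) powr (1 / real t))"

text \<open>\<open>Max\<close> and \<open>card\<close> above are applied to finite sets, in the first case nonempty ones.\<close>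

lemma finite_edges: "finite {w. edge v w}"
proof (rule finite_subset)
  show "{w. edge v w} \<subseteq>
    (range (\<lambda>i. fst v + axis i 1) \<union> range (\<lambda>i. fst v - axis i 1)) \<times> {snd v + 1}"
    by (auto simp: edge_def mem_Times_iff)
qed auto

lemma finite_origin_paths: "finite (origin_paths s :: 'd::finite vertex list set)"
proof (induction s)
  case 0
  have "origin_paths 0 \<subseteq> {[(0, 0) :: 'd vertex]}"
    by (auto simp: origin_paths_def oriented_path_def length_Suc_conv)
  then show ?case by (rule finite_subset) simp
next
  case (Suc s)
  have "origin_paths (Suc s) \<subseteq>
    (\<Union>\<pi> \<in> (origin_paths s :: 'd vertex list set). (\<lambda>w. \<pi> @ [w]) ` {w. edge (last \<pi>) w})"
  proof
    fix \<pi> :: "'d vertex list" assume \<pi>: "\<pi> \<in> origin_paths (Suc s)"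
    then have len: "length \<pi> = Suc (Suc s)"
      and e: "\<And>i. i < Suc s \<Longrightarrow> edge (\<pi> ! i) (\<pi> ! Suc i)" and z: "\<pi> ! 0 = (0, 0)"
      by (auto simp: origin_paths_def oriented_path_def)
    have "butlast \<pi> \<in> origin_paths s"
      using len e z by (auto simp: origin_paths_def oriented_path_def nth_butlast)
    moreover have "edge (last (butlast \<pi>)) (last \<pi>)"
    proof -
      have "butlast \<pi> \<noteq> []" "\<pi> \<noteq> []" using len by (auto simp flip: length_greater_0_conv)
      then show ?thesis using e[of s] len by (simp add: last_conv_nth nth_butlast)
    qed
    moreover have "\<pi> = butlast \<pi> @ [last \<pi>]" using len by (cases \<pi>) auto
    ultimately show "\<pi> \<in> (\<Union>\<pi> \<in> origin_paths s. (\<lambda>w. \<pi> @ [w]) ` {w. edge (last \<pi>) w})"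
      by blast
  qed
  then show ?case by (rule finite_subset) (intro finite_UN_I Suc finite_imageI finite_edges)
qed

lemma origin_paths_nonempty: "origin_paths s \<noteq> ({} :: 'd::finite vertex list set)"
proof -
  obtain i :: 'd where True by simp
  let ?f = "\<lambda>k. ((\<Sum>_<k. axis i 1, k) :: 'd vertex)"
  have "map ?f [0..<s + 1] \<in> origin_paths s"
    by (auto simp: origin_paths_def oriented_path_def edge_def algebra_simps
        simp del: upt_Suc intro!: exI[of _ i])
  then show ?thesis by blast
qed

end

theory Submission
  imports Defs "HOL-Library.Discrete_Functions"
begin

text \<open>
  Why the growth rate exceeds \<open>1\<close>. Let \<open>\<alpha> < \<gamma> < M\<close>. A path may spend a small fraction of its time moving
  arbitrarily and then follow a path whose density of heavy sites is at least \<open>\<gamma>\<close>; the total density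
  stays above \<open>\<alpha>\<close>, and the arbitrary initial stretch alone leaves exponentially many choices. In other
  words, the exponential rate is a concave function of the threshold \<open>\<alpha>\<close>, it is positive at \<open>0\<close> and
  nonnegative below \<open>M\<close>, hence it is positive on \<open>[0, M)\<close>.

  Both \<open>M\<close> and the growth rate denote almost sure constant limits, so the existence of these limits has
  to be proved as well. The number of paths above a threshold is badly behaved for this purpose: it may
  vanish, and a change at a single site may alter it drastically. It is therefore replaced by the soft
  count, the sum over all paths of \<open>exp (- B max(0, a - W))\<close>, in which a path that misses the threshold
  \<open>a\<close> by \<open>k\<close> is discounted by \<open>exp (- B k)\<close>. Its logarithm, the free energy, has three robust properties.

  \<^item> Changing the environment on one level changes it by at most \<open>B\<close>; hence its variance grows at most
    linearly in time (\<open>variance_config_bounded_differences\<close>).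
  \<^item> Its mean is superadditive jointly in time and threshold (\<open>mean_energy_superadditive\<close>): decompose a
    path at an intermediate time and apply Jensen's inequality to the Gibbs average over its first part.
  \<^item> Going from time \<open>t\<close> to \<open>t + 1\<close> changes it by a bounded amount, so that almost sure convergence
    along squares suffices.

  It follows that the free energy with threshold \<open>\<alpha> t\<close>, divided by \<open>t\<close>, converges almost surely to a
  constant (\<open>free_energy_tendsto_AE\<close>), which is concave in \<open>\<alpha>\<close> (\<open>energy_density_concave\<close>). At
  \<open>\<alpha> = 1\<close> and large \<open>B\<close> it determines \<open>M\<close>. For \<open>\<alpha> < \<alpha>' < M\<close> and large \<open>B\<close> the number of paths of
  density at least \<open>\<alpha>\<close> lies, on the exponential scale, between the soft counts with thresholds \<open>\<alpha>' t\<close>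
  and \<open>\<alpha> t\<close> (\<open>hard_count_bounds_AE\<close>), and concavity makes the gap between the two vanish as
  \<open>\<alpha>'\<close> tends to \<open>\<alpha>\<close>.
\<close>

section \<open>Decomposition of oriented paths\<close>

text \<open>
  The path weight for a Boolean environment, as a sum so that it splits along concatenated paths. The
  sum starts at \<open>1\<close> because the starting vertex does not count.
\<close>
definition heavy :: "('d::finite vertex \<Rightarrow> bool) \<Rightarrow> 'd vertex list \<Rightarrow> nat" where
  "heavy \<omega> \<pi> = (\<Sum>i = 1..<length \<pi>. of_bool (\<omega> (\<pi> ! i)))"

lemma path_weight_eq_heavy: "path_weight b x \<pi> = heavy (\<lambda>v. x v = exp b) \<pi>"
proof -
  have "{i. 1 \<le> i \<and> i < length \<pi> \<and> x (\<pi> ! i) = exp b}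
      = {i \<in> {1..<length \<pi>}. x (\<pi> ! i) = exp b}" by auto
  then show ?thesis
    by (simp add: path_weight_def heavy_def sum.If_cases of_bool_def Int_def conj_commute)
qed

lemma origin_paths_length: "\<pi> \<in> origin_paths s \<Longrightarrow> length \<pi> = Suc s"
  by (simp add: origin_paths_def oriented_path_def)

lemma origin_paths_snd:
  assumes "\<pi> \<in> origin_paths s" "i \<le> s"
  shows "snd (\<pi> ! i) = i"
  using assms(2)
proof (induction i)
  case 0
  then show ?case using assms(1) by (simp add: origin_paths_def)
next
  case (Suc i)
  then show ?case using assms(1) by (auto simp: origin_paths_def oriented_path_def edge_def)
qed

lemma heavy_le: "\<pi> \<in> origin_paths s \<Longrightarrow> heavy \<omega> \<pi> \<le> s"
  using sum_bounded_above[of "{1..<length \<pi>}" "\<lambda>i. of_bool (\<omega> (\<pi> ! i))" "1::nat"]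
  by (simp add: heavy_def origin_paths_length of_bool_def)

text \<open>
  The second path is translated to the endpoint of the first; its own starting vertex is dropped because
  it coincides with that endpoint.
\<close>
definition glue :: "'d::finite vertex list \<Rightarrow> 'd vertex list \<Rightarrow> 'd vertex list" where
  "glue \<pi> \<rho> = \<pi> @ map (\<lambda>u. last \<pi> + u) (tl \<rho>)"

lemma origin_paths_nth_0: "\<pi> \<in> origin_paths s \<Longrightarrow> \<pi> ! 0 = 0"
  by (simp add: origin_paths_def zero_prod_def)

lemma origin_paths_last: "\<pi> \<in> origin_paths s \<Longrightarrow> last \<pi> = \<pi> ! s"
  using origin_paths_length[of \<pi> s] by (subst last_conv_nth) auto

lemma length_glue:
  "\<pi> \<in> origin_paths s \<Longrightarrow> \<rho> \<in> origin_paths t \<Longrightarrow> length (glue \<pi> \<rho>) = Suc (s + t)"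
  by (simp add: glue_def origin_paths_length)

lemma nth_glue_left: "\<pi> \<in> origin_paths s \<Longrightarrow> i \<le> s \<Longrightarrow> glue \<pi> \<rho> ! i = \<pi> ! i"
  by (simp add: glue_def nth_append origin_paths_length)

lemma nth_glue_right:
  assumes "\<pi> \<in> origin_paths s" "\<rho> \<in> origin_paths t" "i \<le> t"
  shows "glue \<pi> \<rho> ! (s + i) = last \<pi> + \<rho> ! i"
proof (cases i)
  case 0
  then show ?thesis using assms
    by (simp add: nth_glue_left origin_paths_nth_0 origin_paths_last)
next
  case (Suc j)
  then show ?thesis using assms
    by (simp add: glue_def nth_append origin_paths_length nth_tl)
qed

lemma edge_add_left: "edge (v + u) (v + w) \<longleftrightarrow> edge u w"
  by (auto simp: edge_def algebra_simps)

lemma glue_in_origin_paths: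
  assumes "\<pi> \<in> origin_paths s" "\<rho> \<in> origin_paths t"
  shows "glue \<pi> \<rho> \<in> origin_paths (s + t)"
proof -
  have "edge (glue \<pi> \<rho> ! i) (glue \<pi> \<rho> ! Suc i)" if "i < s + t" for i
  proof (cases "i < s")
    case True
    then show ?thesis using assms
      by (simp add: nth_glue_left) (simp add: origin_paths_def oriented_path_def)
  next
    case False
    then obtain j where j: "i = s + j" "j < t"
      using \<open>i < s + t\<close> by (metis add_less_cancel_left le_Suc_ex not_le)
    have "edge (\<rho> ! j) (\<rho> ! Suc j)"
      using assms(2) j by (simp add: origin_paths_def oriented_path_def)
    then show ?thesis
      using nth_glue_right[OF assms, of j] nth_glue_right[OF assms, of "Suc j"] j
      by (simp add: edge_add_left)
  qed
  moreover have "glue \<pi> \<rho> ! 0 = 0"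
    using assms by (simp add: nth_glue_left origin_paths_nth_0)
  ultimately show ?thesis
    using length_glue[OF assms] by (simp add: origin_paths_def oriented_path_def zero_prod_def)
qed

text \<open>
  The source of all superadditivity below: a path of length \<open>s + t\<close> is a path of length \<open>s\<close>
  followed by a translate of a path of length \<open>t\<close>, in a unique way.
\<close>
lemma bij_betw_glue:
  "bij_betw (\<lambda>(\<pi>, \<rho>). glue \<pi> \<rho>) (origin_paths s \<times> origin_paths t)
     (origin_paths (s + t) :: 'd::finite vertex list set)"
proof (rule bij_betw_imageI)
  show "inj_on (\<lambda>(\<pi>, \<rho>). glue \<pi> \<rho>)
          (origin_paths s \<times> (origin_paths t :: 'd vertex list set))"
  proof (rule inj_onI, clarify)
    fix \<pi> \<rho> \<pi>' \<rho>' :: "'d vertex list"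
    assume p: "\<pi> \<in> origin_paths s" "\<pi>' \<in> origin_paths s"
      and r: "\<rho> \<in> origin_paths t" "\<rho>' \<in> origin_paths t"
      and eq: "glue \<pi> \<rho> = glue \<pi>' \<rho>'"
    have "\<pi> = \<pi>'"
      using eq p by (simp add: glue_def origin_paths_length)
    moreover have "\<rho> = \<rho>'"
    proof (rule nth_equalityI)
      fix i assume "i < length \<rho>"
      then have "i \<le> t" using r by (simp add: origin_paths_length)
      then show "\<rho> ! i = \<rho>' ! i"
        using nth_glue_right[OF p(1) r(1)] nth_glue_right[OF p(2) r(2)] eq \<open>\<pi> = \<pi>'\<close>
        by (metis add_left_cancel)
    qed (use r in \<open>simp add: origin_paths_length\<close>)
    ultimately show "\<pi> = \<pi>' \<and> \<rho> = \<rho>'" by simp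
  qed
  show "(\<lambda>(\<pi>, \<rho>). glue \<pi> \<rho>) ` (origin_paths s \<times> origin_paths t)
          = (origin_paths (s + t) :: 'd vertex list set)"
  proof (intro equalityI subsetI)
    fix \<sigma> :: "'d vertex list" assume \<sigma>: "\<sigma> \<in> origin_paths (s + t)"
    define \<pi> where "\<pi> = take (Suc s) \<sigma>"
    define \<rho> where "\<rho> = map (\<lambda>u. u - \<sigma> ! s) (drop s \<sigma>)"
    have len: "length \<sigma> = Suc (s + t)" using \<sigma> by (rule origin_paths_length)
    have e: "edge (\<sigma> ! i) (\<sigma> ! Suc i)" if "i < s + t" for i
      using \<sigma> that by (simp add: origin_paths_def oriented_path_def)
    have \<pi>: "\<pi> \<in> origin_paths s"
      using len e \<sigma> by (auto simp: origin_paths_def oriented_path_def \<pi>_def)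
    \<comment> \<open>Subtraction on the time coordinate truncates, so this uses that the time along a path increases.\<close>
    have undo: "\<sigma> ! s + (\<sigma> ! (s + i) - \<sigma> ! s) = \<sigma> ! (s + i)" if "i \<le> t" for i
      using origin_paths_snd[OF \<sigma>, of s] origin_paths_snd[OF \<sigma>, of "s + i"] that
      by (simp add: prod_eq_iff)
    have \<rho>: "\<rho> \<in> origin_paths t"
    proof -
      have "edge (\<sigma> ! (s + i) - \<sigma> ! s) (\<sigma> ! Suc (s + i) - \<sigma> ! s)" if "i < t" for i
      proof (subst edge_add_left[of "\<sigma> ! s", symmetric])
        show "edge (\<sigma> ! s + (\<sigma> ! (s + i) - \<sigma> ! s)) (\<sigma> ! s + (\<sigma> ! Suc (s + i) - \<sigma> ! s))"
          using undo[of i] undo[of "Suc i"] e[of "s + i"] that by simp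
      qed
      then show ?thesis
        using len by (simp add: origin_paths_def oriented_path_def \<rho>_def zero_prod_def prod_eq_iff)
    qed
    have "glue \<pi> \<rho> = \<sigma>"
    proof (rule nth_equalityI)
      fix i assume "i < length (glue \<pi> \<rho>)"
      then have i: "i \<le> s + t" using length_glue[OF \<pi> \<rho>] by simp
      show "glue \<pi> \<rho> ! i = \<sigma> ! i"
      proof (cases "i \<le> s")
        case True
        then show ?thesis using \<pi> by (simp add: nth_glue_left) (simp add: \<pi>_def)
      next
        case False
        then obtain j where j: "i = s + j" "j \<le> t"
          using i by (metis add_le_cancel_left le_Suc_ex nat_le_linear)
        then show ?thesis
          using nth_glue_right[OF \<pi> \<rho> j(2)] undo[OF j(2)] len origin_paths_last[OF \<pi>]
          by (simp add: \<pi>_def \<rho>_def)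
      qed
    qed (use len length_glue[OF \<pi> \<rho>] in simp)
    then show "\<sigma> \<in> (\<lambda>(\<pi>, \<rho>). glue \<pi> \<rho>) ` (origin_paths s \<times> origin_paths t)"
      using \<pi> \<rho> by force
  qed (auto simp: glue_in_origin_paths)
qed

lemma heavy_glue:
  assumes "\<pi> \<in> origin_paths s" "\<rho> \<in> origin_paths t"
  shows "heavy \<omega> (glue \<pi> \<rho>) = heavy \<omega> \<pi> + heavy (\<lambda>u. \<omega> (last \<pi> + u)) \<rho>"
proof -
  have "heavy \<omega> (glue \<pi> \<rho>)
      = (\<Sum>i = 1..<Suc s. of_bool (\<omega> (glue \<pi> \<rho> ! i)))
        + (\<Sum>i = 1 + s..<Suc t + s. of_bool (\<omega> (glue \<pi> \<rho> ! i)))"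
    unfolding heavy_def length_glue[OF assms]
    using sum.atLeastLessThan_concat[of 1 "Suc s" "Suc (t + s)" "\<lambda>i. of_bool (\<omega> (glue \<pi> \<rho> ! i)) :: nat"]
    by (simp only: add.commute[of s t] plus_1_eq_Suc add_Suc)
  also have "(\<Sum>i = 1..<Suc s. of_bool (\<omega> (glue \<pi> \<rho> ! i))) = heavy \<omega> \<pi>"
    using assms by (simp add: heavy_def nth_glue_left origin_paths_length)
  also have "(\<Sum>i = 1 + s..<Suc t + s. of_bool (\<omega> (glue \<pi> \<rho> ! i)))
      = heavy (\<lambda>u. \<omega> (last \<pi> + u)) \<rho>"
    unfolding sum.shift_bounds_nat_ivl heavy_def
    using assms by (simp add: nth_glue_right origin_paths_length add.commute[of _ s])
  finally show ?thesis .
qed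

lemma card_origin_paths:
  "card (origin_paths s :: 'd::finite vertex list set) = card (origin_paths 1 :: 'd vertex list set) ^ s"
proof (induction s)
  case 0
  have "origin_paths 0 = {[(0, 0) :: 'd vertex]}"
    by (auto simp: origin_paths_def oriented_path_def length_Suc_conv)
  then show ?case by simp
next
  case (Suc s)
  then show ?case
    using bij_betw_same_card[OF bij_betw_glue[of s 1, where ?'d = 'd]] by (simp add: card_cartesian_product mult.commute)
qed

lemma card_origin_paths_1: "card (origin_paths 1 :: 'd::finite vertex list set) \<ge> 2"
proof -
  obtain i :: 'd where True by simp
  let ?p = "\<lambda>c. [(0, 0), (axis i c, 1)] :: 'd vertex list"
  have "axis i (1::int) \<noteq> axis i (- 1)" by (simp add: axis_eq_axis)
  moreover have "- axis i (1::int) = axis i (- 1)" by (simp add: axis_def vec_eq_iff)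
  ultimately have "card {?p 1, ?p (- 1)} = 2" and "{?p 1, ?p (- 1)} \<subseteq> origin_paths 1"
    by (auto simp: origin_paths_def oriented_path_def edge_def intro: exI[of _ i])
  then show ?thesis using card_mono[OF finite_origin_paths] by metis
qed

section \<open>Soft counts and free energy\<close>

lemma ln_sum_exp_diff:
  fixes u v :: "'a \<Rightarrow> real"
  assumes "finite A" "A \<noteq> {}" "\<And>x. x \<in> A \<Longrightarrow> \<bar>u x - v x\<bar> \<le> c"
  shows "\<bar>ln (\<Sum>x\<in>A. exp (u x)) - ln (\<Sum>x\<in>A. exp (v x))\<bar> \<le> c"
proof -
  have one_sided: "ln (\<Sum>x\<in>A. exp (f x)) \<le> c + ln (\<Sum>x\<in>A. exp (g x))"
    if "\<And>x. x \<in> A \<Longrightarrow> f x \<le> c + g x" for f g :: "'a \<Rightarrow> real"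
  proof -
    have pos: "(\<Sum>x\<in>A. exp (h x)) > 0" for h :: "'a \<Rightarrow> real"
      using assms by (intro sum_pos) auto
    have "(\<Sum>x\<in>A. exp (f x)) \<le> (\<Sum>x\<in>A. exp (c + g x))"
      by (intro sum_mono) (use that in auto)
    also have "\<dots> = exp c * (\<Sum>x\<in>A. exp (g x))"
      by (simp add: exp_add sum_distrib_left)
    finally have "ln (\<Sum>x\<in>A. exp (f x)) \<le> ln (exp c * (\<Sum>x\<in>A. exp (g x)))"
      using pos by (subst ln_le_cancel_iff) auto
    then show ?thesis using pos[of g] by (simp add: ln_mult)
  qed
  have "ln (\<Sum>x\<in>A. exp (u x)) \<le> c + ln (\<Sum>x\<in>A. exp (v x))"
    using assms(3) by (intro one_sided) (smt (verit))
  moreover have "ln (\<Sum>x\<in>A. exp (v x)) \<le> c + ln (\<Sum>x\<in>A. exp (u x))"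
    using assms(3) by (intro one_sided) (smt (verit))
  ultimately show ?thesis by (smt (verit))
qed

text \<open>
  Jensen's inequality for the logarithm, from \<open>ln x \<le> x - 1\<close> at \<open>x = z / S\<close>, where \<open>S\<close> is the weighted mean.
\<close>
lemma sum_ln_le_ln_sum:
  fixes w z :: "'a \<Rightarrow> real"
  assumes "finite A" "\<And>x. x \<in> A \<Longrightarrow> w x \<ge> 0" "(\<Sum>x\<in>A. w x) = 1" "\<And>x. x \<in> A \<Longrightarrow> z x > 0"
  shows "(\<Sum>x\<in>A. w x * ln (z x)) \<le> ln (\<Sum>x\<in>A. w x * z x)"
proof -
  define S where "S = (\<Sum>x\<in>A. w x * z x)"
  have "S > 0"
  proof -
    obtain x where "x \<in> A" "w x > 0"
      using assms by (metis sum_nonpos not_le zero_less_one)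
    then show ?thesis unfolding S_def
      by (intro sum_pos2[of A x]) (use assms in \<open>auto intro!: mult_nonneg_nonneg intro: less_imp_le\<close>)
  qed
  have "(\<Sum>x\<in>A. w x * ln (z x)) \<le> (\<Sum>x\<in>A. w x * (ln S - 1) + (w x * z x) / S)"
  proof (intro sum_mono)
    fix x assume x: "x \<in> A"
    have "ln (z x / S) \<le> z x / S - 1"
      using x assms \<open>S > 0\<close> by (intro ln_le_minus_one) auto
    then have "ln (z x) \<le> (ln S - 1) + z x / S"
      using assms(4)[OF x] \<open>S > 0\<close> by (simp add: ln_div)
    then have "w x * ln (z x) \<le> w x * ((ln S - 1) + z x / S)"
      using x assms by (intro mult_left_mono) auto
    then show "w x * ln (z x) \<le> w x * (ln S - 1) + (w x * z x) / S"
      by (simp add: distrib_left)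
  qed
  also have "\<dots> = ln S"
    using \<open>S > 0\<close> assms(3)
    by (simp add: sum.distrib flip: sum_distrib_right sum_divide_distrib S_def)
  finally show ?thesis by (simp add: S_def)
qed

definition penalty :: "real \<Rightarrow> real \<Rightarrow> nat \<Rightarrow> real" where
  "penalty B a k = B * max 0 (a - real k)"

text \<open>
  As \<open>B\<close> grows, the discount factor approaches the indicator of reaching the threshold \<open>a\<close>.
\<close>
definition soft_count :: "real \<Rightarrow> real \<Rightarrow> nat \<Rightarrow> ('d::finite vertex \<Rightarrow> bool) \<Rightarrow> real" where
  "soft_count B a t \<omega> = (\<Sum>\<pi>\<in>origin_paths t. exp (- penalty B a (heavy \<omega> \<pi>)))"

definition free_energy :: "real \<Rightarrow> real \<Rightarrow> nat \<Rightarrow> ('d::finite vertex \<Rightarrow> bool) \<Rightarrow> real" where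
  "free_energy B a t \<omega> = ln (soft_count B a t \<omega>)"

definition hard_count :: "real \<Rightarrow> nat \<Rightarrow> ('d::finite vertex \<Rightarrow> bool) \<Rightarrow> nat" where
  "hard_count a t \<omega> = card {\<pi> \<in> origin_paths t. a \<le> real (heavy \<omega> \<pi>)}"

text \<open>
  The number of steps available at each vertex. All that matters about it is that it is at least \<open>2\<close> and
  that there are exactly \<open>branching ^ t\<close> paths of length \<open>t\<close>.
\<close>
definition branching :: "'d::finite itself \<Rightarrow> real" where
  "branching _ = real (card (origin_paths 1 :: 'd vertex list set))"


lemma branching_ge_2: "branching TYPE('d::finite) \<ge> 2"
  using card_origin_paths_1[where ?'d = 'd] by (simp add: branching_def)

lemma ln_branching_pos: "ln (branching TYPE('d::finite)) > 0"
  using branching_ge_2[where ?'d = 'd] by (intro ln_gt_zero) simp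

lemma real_card_origin_paths:
  "real (card (origin_paths t :: 'd::finite vertex list set)) = branching TYPE('d) ^ t"
  by (subst card_origin_paths) (simp add: branching_def)

lemma penalty_lipschitz:
  assumes "B \<ge> 0"
  shows "\<bar>penalty B a k - penalty B a' k'\<bar> \<le> B * \<bar>(a - real k) - (a' - real k')\<bar>"
proof -
  have "\<bar>penalty B a k - penalty B a' k'\<bar> = B * \<bar>max 0 (a - real k) - max 0 (a' - real k')\<bar>"
    using assms by (simp add: penalty_def abs_mult flip: right_diff_distrib)
  also have "\<dots> \<le> B * \<bar>(a - real k) - (a' - real k')\<bar>"
    using assms by (intro mult_left_mono) (auto simp: max_def)
  finally show ?thesis .
qed

text \<open>
  Subadditivity of the positive part. The inequality is strict only if a surplus in one part of a path
  offsets a deficit in the other.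
\<close>
lemma penalty_add_le:
  "B \<ge> 0 \<Longrightarrow> penalty B (a + a') (k + k') \<le> penalty B a k + penalty B a' k'"
  unfolding penalty_def by (subst distrib_left[symmetric], intro mult_left_mono) auto

lemma penalty_nonneg: "B \<ge> 0 \<Longrightarrow> penalty B a k \<ge> 0"
  by (simp add: penalty_def)

lemma soft_count_pos: "soft_count B a t \<omega> > 0"
  unfolding soft_count_def by (intro sum_pos finite_origin_paths origin_paths_nonempty) auto

lemma soft_count_0: "soft_count B 0 t (\<omega> :: 'd::finite vertex \<Rightarrow> bool) = branching TYPE('d) ^ t"
  by (simp add: soft_count_def penalty_def real_card_origin_paths)

lemma free_energy_0:
  "free_energy B 0 t (\<omega> :: 'd::finite vertex \<Rightarrow> bool) = t * ln (branching TYPE('d))"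
  using branching_ge_2[where ?'d = 'd] by (simp add: free_energy_def soft_count_0 ln_realpow)

lemma abs_free_energy_diff_le:
  assumes "B \<ge> 0" "\<And>\<pi>. \<pi> \<in> origin_paths t \<Longrightarrow> \<bar>real (heavy \<omega> \<pi>) - real (heavy \<omega>' \<pi>)\<bar> \<le> 1"
  shows "\<bar>free_energy B a t \<omega> - free_energy B a t \<omega>'\<bar> \<le> B"
  unfolding free_energy_def soft_count_def
proof (rule ln_sum_exp_diff)
  fix \<pi> :: "'a vertex list" assume \<pi>: "\<pi> \<in> origin_paths t"
  have "\<bar>penalty B a (heavy \<omega> \<pi>) - penalty B a (heavy \<omega>' \<pi>)\<bar>
      \<le> B * \<bar>real (heavy \<omega> \<pi>) - real (heavy \<omega>' \<pi>)\<bar>"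
    using penalty_lipschitz[OF assms(1), of a "heavy \<omega> \<pi>" a "heavy \<omega>' \<pi>"] by (simp add: abs_minus_commute)
  also have "\<dots> \<le> B * 1" using assms \<pi> by (intro mult_left_mono) auto
  finally show "\<bar>- penalty B a (heavy \<omega> \<pi>) - - penalty B a (heavy \<omega>' \<pi>)\<bar> \<le> B" by simp
qed (auto simp: finite_origin_paths origin_paths_nonempty)

lemma free_energy_threshold_diff:
  assumes "B \<ge> 0"
  shows "\<bar>free_energy B a t \<omega> - free_energy B a' t \<omega>\<bar> \<le> B * \<bar>a - a'\<bar>"
  unfolding free_energy_def soft_count_def
proof (rule ln_sum_exp_diff)
  fix \<pi> :: "'a vertex list"
  show "\<bar>- penalty B a (heavy \<omega> \<pi>) - - penalty B a' (heavy \<omega> \<pi>)\<bar> \<le> B * \<bar>a - a'\<bar>"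
    using penalty_lipschitz[OF assms, of a "heavy \<omega> \<pi>" a' "heavy \<omega> \<pi>"] by simp
qed (auto simp: finite_origin_paths origin_paths_nonempty)

lemma abs_free_energy_le:
  fixes \<omega> :: "'d::finite vertex \<Rightarrow> bool"
  assumes "B \<ge> 0" "a \<ge> 0"
  shows "\<bar>free_energy B a t \<omega>\<bar> \<le> t * ln (branching TYPE('d)) + B * a"
  using free_energy_threshold_diff[OF assms(1), of a t \<omega> 0] free_energy_0[of B t \<omega>]
    ln_branching_pos[where ?'d = 'd] assms(2)
  by (smt (verit, best) of_nat_0_le_iff mult_nonneg_nonneg)

lemma free_energy_le:
  fixes \<omega> :: "'d::finite vertex \<Rightarrow> bool"
  assumes "B \<ge> 0"
  shows "free_energy B a t \<omega> \<le> t * ln (branching TYPE('d))"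
proof -
  have "soft_count B a t \<omega> \<le> (\<Sum>\<pi>\<in>(origin_paths t :: 'd vertex list set). 1)"
    unfolding soft_count_def by (intro sum_mono) (use assms in \<open>simp add: penalty_nonneg\<close>)
  then have "free_energy B a t \<omega> \<le> ln (branching TYPE('d) ^ t)"
    using soft_count_pos[of B a t \<omega>] by (simp add: free_energy_def real_card_origin_paths)
  then show ?thesis
    using branching_ge_2[where ?'d = 'd] by (simp add: ln_realpow)
qed

lemma soft_count_add:
  "soft_count B a (s + t) \<omega> = (\<Sum>(\<pi>, \<rho>)\<in>origin_paths s \<times> origin_paths t.
     exp (- penalty B a (heavy \<omega> \<pi> + heavy (\<lambda>u. \<omega> (last \<pi> + u)) \<rho>)))"
  unfolding soft_count_def
  by (subst sum.reindex_bij_betw[OF bij_betw_glue, symmetric])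
    (auto intro!: sum.cong simp: heavy_glue)

text \<open>
  Appending one step multiplies the number of paths by the branching number and moves the deficit of
  each path by at most \<open>1 + \<alpha>\<close>.
\<close>
lemma free_energy_step:
  fixes \<omega> :: "'d::finite vertex \<Rightarrow> bool"
  assumes "B \<ge> 0" "\<alpha> \<ge> 0"
  shows "\<bar>free_energy B (\<alpha> * real (Suc t)) (Suc t) \<omega> - free_energy B (\<alpha> * real t) t \<omega>\<bar>
    \<le> ln (branching TYPE('d)) + B * (1 + \<alpha>)"
proof -
  let ?P = "(origin_paths t :: 'd vertex list set) \<times> (origin_paths 1 :: 'd vertex list set)"
  have 1: "free_energy B (\<alpha> * real (Suc t)) (Suc t) \<omega> = ln (\<Sum>x\<in>?P. exp (- penalty B (\<alpha> * real (Suc t))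
      (heavy \<omega> (fst x) + heavy (\<lambda>u. \<omega> (last (fst x) + u)) (snd x))))"
    using soft_count_add[of B "\<alpha> * real (Suc t)" t 1 \<omega>]
    by (simp add: free_energy_def case_prod_beta)
  have "(\<Sum>x\<in>?P. exp (- penalty B (\<alpha> * real t) (heavy \<omega> (fst x))))
      = soft_count B (\<alpha> * real t) t \<omega> * branching TYPE('d)"
    using sum.cartesian_product[of "\<lambda>\<pi> \<rho>. exp (- penalty B (\<alpha> * real t) (heavy \<omega> \<pi>))"
        "origin_paths 1 :: 'd vertex list set" "origin_paths t", symmetric]
    by (simp add: soft_count_def branching_def mult.commute sum_distrib_left case_prod_beta)
  then have 2: "ln (\<Sum>x\<in>?P. exp (- penalty B (\<alpha> * real t) (heavy \<omega> (fst x))))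
      = free_energy B (\<alpha> * real t) t \<omega> + ln (branching TYPE('d))"
    using soft_count_pos[of B "\<alpha> * real t" t \<omega>] branching_ge_2[where ?'d = 'd]
    by (simp add: free_energy_def ln_mult)
  have 3: "\<bar>free_energy B (\<alpha> * real (Suc t)) (Suc t) \<omega>
      - (free_energy B (\<alpha> * real t) t \<omega> + ln (branching TYPE('d)))\<bar> \<le> B * (1 + \<alpha>)"
    unfolding 1 2[symmetric]
  proof (rule ln_sum_exp_diff)
    fix x :: "'d vertex list \<times> 'd vertex list" assume "x \<in> ?P"
    let ?k = "heavy \<omega> (fst x)" and ?l = "heavy (\<lambda>u. \<omega> (last (fst x) + u)) (snd x)"
    have "?l \<le> 1" using \<open>x \<in> ?P\<close> by (intro heavy_le) auto
    have "\<bar>penalty B (\<alpha> * real (Suc t)) (?k + ?l) - penalty B (\<alpha> * real t) ?k\<bar>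
        \<le> B * \<bar>(\<alpha> * real (Suc t) - real (?k + ?l)) - (\<alpha> * real t - real ?k)\<bar>"
      by (rule penalty_lipschitz[OF assms(1)])
    also have "\<dots> \<le> B * (1 + \<alpha>)"
      using \<open>?l \<le> 1\<close> assms by (intro mult_left_mono) (auto simp: algebra_simps)
    finally show "\<bar>- penalty B (\<alpha> * real (Suc t)) (?k + ?l) - - penalty B (\<alpha> * real t) ?k\<bar>
        \<le> B * (1 + \<alpha>)" by simp
  qed (auto simp: finite_origin_paths origin_paths_nonempty)
  then show ?thesis using ln_branching_pos[where ?'d = 'd] by linarith
qed

text \<open>
  The law on paths of length \<open>s\<close> under which the soft count is the partition function; it depends on the
  environment up to time \<open>s\<close> only.
\<close>
definition gibbs_weight ::
  "real \<Rightarrow> real \<Rightarrow> nat \<Rightarrow> ('d::finite vertex \<Rightarrow> bool) \<Rightarrow> 'd vertex list \<Rightarrow> real" where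
  "gibbs_weight B a s \<omega> \<pi> = exp (- penalty B a (heavy \<omega> \<pi>)) / soft_count B a s \<omega>"

lemma gibbs_weight_nonneg: "gibbs_weight B a s \<omega> \<pi> \<ge> 0"
  using soft_count_pos[of B a s \<omega>] by (simp add: gibbs_weight_def)

lemma sum_gibbs_weight: "(\<Sum>\<pi>\<in>origin_paths s. gibbs_weight B a s \<omega> \<pi>) = 1"
  using soft_count_pos[of B a s \<omega>]
  by (simp add: gibbs_weight_def soft_count_def flip: sum_divide_distrib)

text \<open>
  The soft count up to time \<open>s + t\<close> is at least the one up to time \<open>s\<close> times the Gibbs average of the soft
  counts seen from the endpoints. Jensen's inequality moves the logarithm inside this average. Once the
  environment after time \<open>s\<close> is averaged out, every term of the sum has the same mean, whatever the
  endpoint.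
\<close>
lemma free_energy_superadditive:
  fixes \<omega> :: "'d::finite vertex \<Rightarrow> bool"
  assumes "B \<ge> 0"
  shows "free_energy B (a + a') (s + t) \<omega> \<ge> free_energy B a s \<omega>
    + (\<Sum>\<pi>\<in>origin_paths s. gibbs_weight B a s \<omega> \<pi> * free_energy B a' t (\<lambda>u. \<omega> (last \<pi> + u)))"
proof -
  let ?z = "\<lambda>\<pi>. soft_count B a' t (\<lambda>u. \<omega> (last \<pi> + u))"
  have "soft_count B a s \<omega> * (\<Sum>\<pi>\<in>origin_paths s. gibbs_weight B a s \<omega> \<pi> * ?z \<pi>)
      = (\<Sum>\<pi>\<in>origin_paths s. exp (- penalty B a (heavy \<omega> \<pi>)) * ?z \<pi>)"
    using soft_count_pos[of B a s \<omega>] by (simp add: sum_distrib_left gibbs_weight_def)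
  also have "\<dots> = (\<Sum>(\<pi>, \<rho>)\<in>origin_paths s \<times> origin_paths t. exp (- (penalty B a (heavy \<omega> \<pi>)
      + penalty B a' (heavy (\<lambda>u. \<omega> (last \<pi> + u)) \<rho>))))"
    by (simp add: soft_count_def sum_distrib_left exp_diff exp_minus divide_inverse
        flip: sum.cartesian_product exp_add)
  also have "\<dots> \<le> soft_count B (a + a') (s + t) \<omega>"
    unfolding soft_count_add
  proof (rule sum_mono)
    fix x :: "'d vertex list \<times> 'd vertex list"
    show "(case x of (\<pi>, \<rho>) \<Rightarrow>
          exp (- (penalty B a (heavy \<omega> \<pi>) + penalty B a' (heavy (\<lambda>u. \<omega> (last \<pi> + u)) \<rho>))))
        \<le> (case x of (\<pi>, \<rho>) \<Rightarrow>
          exp (- penalty B (a + a') (heavy \<omega> \<pi> + heavy (\<lambda>u. \<omega> (last \<pi> + u)) \<rho>)))"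
      unfolding case_prod_beta exp_le_cancel_iff neg_le_iff_le by (rule penalty_add_le[OF assms])
  qed
  finally have le: "soft_count B a s \<omega> * (\<Sum>\<pi>\<in>origin_paths s. gibbs_weight B a s \<omega> \<pi> * ?z \<pi>)
      \<le> soft_count B (a + a') (s + t) \<omega>" (is "?Z * ?S \<le> _") .
  have S: "?S > 0"
    using soft_count_pos
    by (intro sum_pos finite_origin_paths origin_paths_nonempty)
      (auto simp: gibbs_weight_def intro!: divide_pos_pos mult_pos_pos)
  have "free_energy B a s \<omega>
      + (\<Sum>\<pi>\<in>origin_paths s. gibbs_weight B a s \<omega> \<pi> * free_energy B a' t (\<lambda>u. \<omega> (last \<pi> + u)))
      \<le> free_energy B a s \<omega> + ln ?S"
    unfolding free_energy_def
    using sum_ln_le_ln_sum[OF finite_origin_paths gibbs_weight_nonneg sum_gibbs_weight, of s ?z B a \<omega>]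
    by (simp add: soft_count_pos)
  also have "\<dots> = ln (?Z * ?S)"
    using S soft_count_pos[of B a s \<omega>] by (simp add: ln_mult free_energy_def)
  also have "\<dots> \<le> free_energy B (a + a') (s + t) \<omega>"
    unfolding free_energy_def using le S soft_count_pos[of B a s \<omega>] by (intro ln_mono) auto
  finally show ?thesis .
qed

lemma hard_count_le_soft_count: "real (hard_count a t \<omega>) \<le> soft_count B a t \<omega>"
proof -
  let ?A = "{\<pi> \<in> origin_paths t. a \<le> real (heavy \<omega> \<pi>)}"
  have "real (hard_count a t \<omega>) = (\<Sum>\<pi>\<in>?A. exp (- penalty B a (heavy \<omega> \<pi>)))"
    by (simp add: hard_count_def penalty_def)
  also have "\<dots> \<le> soft_count B a t \<omega>"
    unfolding soft_count_def by (intro sum_mono2 finite_origin_paths) auto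
  finally show ?thesis .
qed

text \<open>
  A path below the lower threshold \<open>a\<close> is discounted so heavily that all such paths together contribute
  at most \<open>1\<close>: each of them at most the reciprocal of the number of all paths.
\<close>
lemma soft_count_le_hard_count:
  fixes \<omega> :: "'d::finite vertex \<Rightarrow> bool"
  assumes "B \<ge> 0" "t * ln (branching TYPE('d)) \<le> B * (a' - a)"
  shows "soft_count B a' t \<omega> \<le> real (hard_count a t \<omega>) + 1"
proof -
  let ?O = "origin_paths t :: 'd vertex list set"
  let ?q = "exp (- (t * ln (branching TYPE('d))))"
  have "soft_count B a' t \<omega> \<le> (\<Sum>\<pi>\<in>?O. of_bool (a \<le> real (heavy \<omega> \<pi>)) + ?q)"
    unfolding soft_count_def
  proof (intro sum_mono)
    fix \<pi> assume "\<pi> \<in> ?O"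
    show "exp (- penalty B a' (heavy \<omega> \<pi>)) \<le> of_bool (a \<le> real (heavy \<omega> \<pi>)) + ?q"
    proof (cases "a \<le> real (heavy \<omega> \<pi>)")
      case True
      have "exp (- penalty B a' (heavy \<omega> \<pi>)) \<le> 1"
        using assms by (simp add: penalty_nonneg)
      then show ?thesis using True by (simp add: add_increasing2)
    next
      case False
      then have "B * (a' - a) \<le> penalty B a' (heavy \<omega> \<pi>)"
        unfolding penalty_def using assms(1) by (intro mult_left_mono) auto
      then show ?thesis using assms(2) False by simp
    qed
  qed
  also have "\<dots> = real (hard_count a t \<omega>) + branching TYPE('d) ^ t * ?q"
    by (simp add: sum.distrib real_card_origin_paths hard_count_def of_bool_def sum.If_cases
        finite_origin_paths Int_def)
  also have "branching TYPE('d) ^ t * ?q = 1"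
    using branching_ge_2[where ?'d = 'd] by (simp add: exp_minus exp_of_nat_mult)
  finally show ?thesis .
qed

text \<open>
  At threshold \<open>t\<close> the positive part is redundant, so the soft count is the sum of \<open>exp (B W)\<close> up to the
  factor \<open>exp (- B t)\<close>. It lies between its largest term and that term times the number of paths; the
  error vanishes as \<open>B\<close> grows.
\<close>
lemma max_heavy_vs_free_energy:
  fixes \<omega> :: "'d::finite vertex \<Rightarrow> bool"
  assumes "B > 0" "t > 0"
  shows "\<bar>(MAX \<pi>\<in>origin_paths t. (1 / real t) * real (heavy \<omega> \<pi>))
    - (free_energy B (real t) t \<omega> / (real t * B) + 1)\<bar> \<le> ln (branching TYPE('d)) / B"
proof -
  let ?O = "origin_paths t :: 'd vertex list set"
  define h where "h = (MAX \<pi>\<in>?O. (1 / real t) * real (heavy \<omega> \<pi>))"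
  have pen: "penalty B (real t) (heavy \<omega> \<pi>) = B * (real t - real (heavy \<omega> \<pi>))" if "\<pi> \<in> ?O" for \<pi>
    using heavy_le[OF that, of \<omega>] by (simp add: penalty_def)
  have "h \<in> (\<lambda>\<pi>. (1 / real t) * real (heavy \<omega> \<pi>)) ` ?O"
    unfolding h_def by (intro Max_in finite_imageI finite_origin_paths) (simp add: origin_paths_nonempty)
  then obtain \<pi>0 where \<pi>0: "\<pi>0 \<in> ?O" "h = (1 / real t) * real (heavy \<omega> \<pi>0)" by auto
  have le: "real (heavy \<omega> \<pi>) \<le> t * h" if "\<pi> \<in> ?O" for \<pi>
  proof -
    have "(1 / real t) * real (heavy \<omega> \<pi>) \<le> h"
      unfolding h_def by (rule Max_ge) (use that finite_origin_paths in auto)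
    then show ?thesis using assms by (simp add: field_simps)
  qed
  have "exp (- (B * (t - t * h))) \<le> soft_count B (real t) t \<omega>"
  proof -
    have "exp (- penalty B (real t) (heavy \<omega> \<pi>0)) \<le> soft_count B (real t) t \<omega>"
      unfolding soft_count_def by (rule member_le_sum) (use \<pi>0 finite_origin_paths in auto)
    then show ?thesis using \<pi>0 assms by (simp add: pen)
  qed
  then have lower: "- (B * (t - t * h)) \<le> free_energy B (real t) t \<omega>"
    unfolding free_energy_def using soft_count_pos[of B "real t" t \<omega>] by (subst ln_ge_iff) auto
  have "soft_count B (real t) t \<omega> \<le> (\<Sum>\<pi>\<in>?O. exp (- (B * (t - t * h))))"
    unfolding soft_count_def using le assms by (intro sum_mono) (simp add: pen)
  also have "\<dots> = branching TYPE('d) ^ t * exp (- (B * (t - t * h)))"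
    by (simp add: real_card_origin_paths)
  finally have "free_energy B (real t) t \<omega> \<le> ln (branching TYPE('d) ^ t * exp (- (B * (t - t * h))))"
    unfolding free_energy_def using soft_count_pos[of B "real t" t \<omega>] by (intro ln_mono) auto
  also have "\<dots> = t * ln (branching TYPE('d)) - B * (t - t * h)"
    using branching_ge_2[where ?'d = 'd] by (simp add: ln_mult ln_realpow)
  finally have upper: "free_energy B (real t) t \<omega> \<le> t * ln (branching TYPE('d)) - B * (t - t * h)" .
  define F where "F = free_energy B (real t) t \<omega>"
  define x where "x = (F + B * (t - t * h)) / (real t * B)"
  have "h - (F / (real t * B) + 1) = - x"
    using assms by (simp add: x_def field_simps)
  moreover have "0 \<le> x"
    using lower assms by (simp add: F_def x_def)
  moreover have "x \<le> (t * ln (branching TYPE('d))) / (real t * B)"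
    unfolding x_def using upper assms by (intro divide_right_mono) (auto simp: F_def)
  moreover have "(t * ln (branching TYPE('d))) / (real t * B) = ln (branching TYPE('d)) / B"
    using assms by simp
  ultimately show ?thesis unfolding h_def[symmetric] F_def[symmetric] by simp
qed

section \<open>Superadditive sequences and almost sure limits\<close>

text \<open>
  Fekete's lemma: division of \<open>t\<close> by a fixed \<open>m\<close> with \<open>e m / m\<close> close to the supremum shows that the
  ratio is eventually close to the supremum.
\<close>
lemma superadditive_imp_convergent:
  fixes e :: "nat \<Rightarrow> real" and C :: real
  assumes super: "\<And>s t. e s + e t \<le> e (s + t)" and bound: "\<And>t. \<bar>e t\<bar> \<le> C * t"
  shows "convergent (\<lambda>t. e t / t)"
proof -
  define L where "L = (SUP t\<in>{1..}. e t / real t)"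
  have le_C: "e t / real t \<le> C" if "t \<ge> 1" for t
  proof -
    have "e t \<le> C * t" using bound[of t] by linarith
    then show ?thesis using that by (simp add: pos_divide_le_eq)
  qed
  have bdd: "bdd_above ((\<lambda>t. e t / real t) ` {1..})"
    using le_C by (intro bdd_aboveI[of _ C]) auto
  have le_L: "e t / real t \<le> L" if "t \<ge> 1" for t
    unfolding L_def using that by (intro cSUP_upper bdd) auto
  have mult: "real q * e m \<le> e (q * m)" for q m
  proof (induction q)
    case 0
    then show ?case using bound[of 0] by simp
  next
    case (Suc q)
    then show ?case using super[of m "q * m"] by (simp add: algebra_simps)
  qed
  have lower: "e m / m - 2 * C * m / t \<le> e t / t" if "m \<ge> 1" "t \<ge> 1" for m t :: nat
  proof -
    define q r where "q = t div m" and "r = t mod m"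
    have t: "t = q * m + r" and r: "r < m"
      using that by (auto simp: q_def r_def)
    have C: "C \<ge> 0" using bound[of 1] by simp
    have "real q * e m = (real t - real r) * (e m / m)"
      using that by (simp add: t)
    also have "\<dots> = t * (e m / m) - r * (e m / m)"
      by (rule left_diff_distrib)
    finally have "real q * e m = t * (e m / m) - r * (e m / m)" .
    moreover have "r * (e m / m) \<le> m * C"
      using r C by (intro order_trans[OF mult_left_mono[OF le_C[OF that(1)]] mult_right_mono]) auto
    moreover have "real q * e m + e r \<le> e t"
      using mult[of q m] super[of "q * m" r] by (simp add: t)
    moreover have "- (m * C) \<le> e r"
    proof -
      have "- e r \<le> C * r" using bound[of r] by linarith
      also have "\<dots> \<le> C * m" using r C by (intro mult_left_mono) auto
      finally show ?thesis by (simp add: mult.commute)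
    qed
    ultimately have "t * (e m / m) - 2 * C * m \<le> e t" by (simp add: algebra_simps)
    then have "(t * (e m / m) - 2 * C * m) / t \<le> e t / t"
      by (intro divide_right_mono) auto
    then show ?thesis using that by (simp add: diff_divide_distrib)
  qed
  have "(\<lambda>t. e t / t) \<longlonglongrightarrow> L"
  proof (rule order_tendstoI)
    fix a assume "a < L"
    then obtain m where m: "m \<ge> 1" "a < e m / real m"
      unfolding L_def by (subst (asm) less_cSUP_iff[OF _ bdd]) auto
    have "(\<lambda>t. e m / m - 2 * C * m / real t) \<longlonglongrightarrow> e m / m - 0"
      by (intro tendsto_diff tendsto_const lim_const_over_n)
    then have "\<forall>\<^sub>F t in sequentially. a < e m / m - 2 * C * m / real t"
      by (rule order_tendstoD(1)) (use m in simp)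
    then show "\<forall>\<^sub>F t in sequentially. a < e t / real t"
      using eventually_ge_at_top[of 1]
      by eventually_elim (use lower m in \<open>meson less_le_trans\<close>)
  next
    fix a assume "L < a"
    show "\<forall>\<^sub>F t in sequentially. e t / real t < a"
      using eventually_ge_at_top[of 1]
      by eventually_elim (use le_L \<open>L < a\<close> in \<open>meson le_less_trans\<close>)
  qed
  then show ?thesis by (rule convergentI)
qed

lemma filterlim_floor_sqrt: "filterlim floor_sqrt at_top at_top"
  unfolding filterlim_at_top
proof
  fix n :: nat
  show "\<forall>\<^sub>F t in sequentially. n \<le> floor_sqrt t"
    using eventually_ge_at_top[of "n\<^sup>2"]
    by eventually_elim (metis mono_floor_sqrt' floor_sqrt_inverse_power2)
qed

text \<open>
  Consecutive squares \<open>n\<^sup>2\<close> and \<open>(n + 1)\<^sup>2\<close> differ by \<open>2 n + 1\<close>, which is small relative to \<open>n\<^sup>2\<close>.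
\<close>
lemma lipschitz_ratio_tendsto_0:
  fixes a :: "nat \<Rightarrow> real" and C :: real
  assumes step: "\<And>t. \<bar>a (Suc t) - a t\<bar> \<le> C" and sq: "(\<lambda>n. a (n\<^sup>2) / real (n\<^sup>2)) \<longlonglongrightarrow> 0"
  shows "(\<lambda>t. a t / t) \<longlonglongrightarrow> 0"
proof -
  have dist: "\<bar>a (m + k) - a m\<bar> \<le> C * k" for m k
  proof (induction k)
    case (Suc k)
    then show ?case using step[of "m + k"] by (simp add: algebra_simps)
  qed simp
  have C: "C \<ge> 0" using step[of 0] by linarith
  have bound: "\<bar>a t / t\<bar> \<le> \<bar>a (n\<^sup>2) / real (n\<^sup>2)\<bar> + 2 * C / n"
    if t: "t \<ge> 1" and n: "n = floor_sqrt t" for t n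
  proof -
    have n1: "n \<ge> 1" unfolding n using t by (metis mono_floor_sqrt' floor_sqrt_one)
    have le: "n\<^sup>2 \<le> t" unfolding n by simp
    have "t < (Suc n)\<^sup>2" unfolding n by (rule Suc_floor_sqrt_power2_gt)
    then have diff: "t - n\<^sup>2 \<le> 2 * n" by (simp add: power2_eq_square)
    have "\<bar>a t\<bar> \<le> \<bar>a (n\<^sup>2)\<bar> + C * (t - n\<^sup>2)"
      using dist[of "n\<^sup>2" "t - n\<^sup>2"] le by simp
    also have "C * (t - n\<^sup>2) \<le> C * (2 * n)"
      using diff C by (intro mult_left_mono) (simp_all only: of_nat_le_iff)
    finally have 1: "\<bar>a t\<bar> \<le> \<bar>a (n\<^sup>2)\<bar> + C * (2 * n)" by simp
    have "\<bar>a t / t\<bar> = \<bar>a t\<bar> / t" by simp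
    also have "\<dots> \<le> (\<bar>a (n\<^sup>2)\<bar> + C * (2 * n)) / t"
      using 1 by (intro divide_right_mono) auto
    also have "\<dots> \<le> (\<bar>a (n\<^sup>2)\<bar> + C * (2 * n)) / real (n\<^sup>2)"
      using le n1 C t by (intro divide_left_mono mult_pos_pos) (auto simp flip: of_nat_power)
    also have "\<dots> = \<bar>a (n\<^sup>2) / real (n\<^sup>2)\<bar> + 2 * C / n"
      using n1 by (simp add: add_divide_distrib power2_eq_square)
    finally show ?thesis .
  qed
  have "(\<lambda>n. \<bar>a (n\<^sup>2) / real (n\<^sup>2)\<bar> + 2 * C / real n) \<longlonglongrightarrow> 0"
    using tendsto_add[OF tendsto_rabs_zero[OF sq] lim_const_over_n[of "2 * C"]] by simp
  then have lim: "(\<lambda>t. \<bar>a ((floor_sqrt t)\<^sup>2) / real ((floor_sqrt t)\<^sup>2)\<bar> + 2 * C / real (floor_sqrt t)) \<longlonglongrightarrow> 0"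
    by (rule filterlim_compose[OF _ filterlim_floor_sqrt])
  show ?thesis
    by (rule Lim_null_comparison[OF _ lim])
      (use eventually_ge_at_top[of 1] in \<open>eventually_elim, use bound in \<open>simp only: real_norm_def\<close>\<close>)
qed

text \<open>
  The sum of the squares has finite mean, so it is almost surely finite and its terms tend to \<open>0\<close>.
\<close>
lemma (in prob_space) AE_tendsto_0_of_summable_second_moment:
  assumes [measurable]: "\<And>n. X n \<in> borel_measurable M"
    and int: "\<And>n. integrable M (\<lambda>\<omega>. (X n \<omega>)\<^sup>2)"
    and le: "\<And>n. expectation (\<lambda>\<omega>. (X n \<omega>)\<^sup>2) \<le> b n"
    and b: "summable (b :: nat \<Rightarrow> real)"
  shows "AE \<omega> in M. (\<lambda>n. X n \<omega>) \<longlonglongrightarrow> 0"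
proof -
  have b0: "b n \<ge> 0" for n
    by (rule order_trans[OF _ le]) (simp add: integral_nonneg_AE)
  have "(\<integral>\<^sup>+ \<omega>. (\<Sum>n. ennreal ((X n \<omega>)\<^sup>2)) \<partial>M) = (\<Sum>n. \<integral>\<^sup>+ \<omega>. ennreal ((X n \<omega>)\<^sup>2) \<partial>M)"
    by (intro nn_integral_suminf) auto
  also have "\<dots> = (\<Sum>n. ennreal (expectation (\<lambda>\<omega>. (X n \<omega>)\<^sup>2)))"
    using int by (subst nn_integral_eq_integral) auto
  also have "\<dots> \<le> (\<Sum>n. ennreal (b n))"
    using le by (intro suminf_le) (auto intro: ennreal_leI)
  also have "\<dots> = ennreal (\<Sum>n. b n)"
    by (rule suminf_ennreal2[OF b0 b])
  finally have "(\<integral>\<^sup>+ \<omega>. (\<Sum>n. ennreal ((X n \<omega>)\<^sup>2)) \<partial>M) \<noteq> \<infinity>"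
    by (auto simp: top_unique)
  then have "AE \<omega> in M. (\<Sum>n. ennreal ((X n \<omega>)\<^sup>2)) \<noteq> \<infinity>"
    by (intro nn_integral_PInf_AE) auto
  then show ?thesis
  proof eventually_elim
    case (elim \<omega>)
    then have "summable (\<lambda>n. (X n \<omega>)\<^sup>2)"
      by (intro summable_suminf_not_top) auto
    then have "(\<lambda>n. (X n \<omega>)\<^sup>2) \<longlonglongrightarrow> 0" by (rule summable_LIMSEQ_zero)
    then show ?case by (simp add: tendsto_power_zero power_eq_0_iff tendsto_null_power)
  qed
qed

text \<open>
  Approximation within \<open>\<epsilon> n\<close> of a deterministic \<open>c n\<close>, for every \<open>n\<close>, forces \<open>c\<close> to be a Cauchy sequence;
  its limit is then the almost sure limit. Both \<open>M\<close> and the growth rate are obtained in this way, from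
  approximations by free energies.
\<close>
lemma (in prob_space) AE_tendsto_const_of_approx:
  fixes X :: "nat \<Rightarrow> 'a \<Rightarrow> real" and c \<epsilon> :: "nat \<Rightarrow> real"
  assumes approx: "\<And>n. AE \<omega> in M. \<forall>\<^sub>F t in sequentially. \<bar>X t \<omega> - c n\<bar> \<le> \<epsilon> n"
    and \<epsilon>: "\<epsilon> \<longlonglongrightarrow> 0"
  obtains L where "AE \<omega> in M. (\<lambda>t. X t \<omega>) \<longlonglongrightarrow> L"
proof -
  have ae: "AE \<omega> in M. \<forall>n. \<forall>\<^sub>F t in sequentially. \<bar>X t \<omega> - c n\<bar> \<le> \<epsilon> n"
    using approx by (simp add: AE_all_countable)
  have "Cauchy c"
  proof (rule metric_CauchyI)
    fix r :: real assume "r > 0"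
    from ae obtain \<omega> where \<omega>: "\<And>n. \<forall>\<^sub>F t in sequentially. \<bar>X t \<omega> - c n\<bar> \<le> \<epsilon> n"
      using eventually_happens'[OF ae_filter_bot ae] by blast
    have "\<forall>\<^sub>F n in sequentially. \<epsilon> n < r / 2"
      using \<epsilon> \<open>r > 0\<close> by (intro order_tendstoD(2)) auto
    then obtain N where N: "\<And>n. n \<ge> N \<Longrightarrow> \<epsilon> n < r / 2"
      by (auto simp: eventually_sequentially)
    have "dist (c m) (c n) < r" if "m \<ge> N" "n \<ge> N" for m n
    proof -
      have "\<forall>\<^sub>F t in sequentially. \<bar>c m - c n\<bar> < r"
        using \<omega>[of m] \<omega>[of n] by eventually_elim (use N[of m] N[of n] that in linarith)
      then show ?thesis by (simp add: dist_real_def)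
    qed
    then show "\<exists>N. \<forall>m\<ge>N. \<forall>n\<ge>N. dist (c m) (c n) < r" by blast
  qed
  then obtain L where L: "c \<longlonglongrightarrow> L"
    by (auto simp: Cauchy_convergent_iff convergent_def)
  have "AE \<omega> in M. (\<lambda>t. X t \<omega>) \<longlonglongrightarrow> L"
    using ae
  proof eventually_elim
    case (elim \<omega>)
    show ?case
    proof (rule tendstoI)
      fix r :: real assume "r > 0"
      have "\<forall>\<^sub>F n in sequentially. \<epsilon> n < r / 2"
        using \<epsilon> \<open>r > 0\<close> by (intro order_tendstoD(2)) auto
      moreover have "\<forall>\<^sub>F n in sequentially. dist (c n) L < r / 2"
        using L \<open>r > 0\<close> by (intro tendstoD) auto
      ultimately obtain n where n: "\<epsilon> n < r / 2" "dist (c n) L < r / 2"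
        using eventually_happens[OF eventually_conj] by fastforce
      show "\<forall>\<^sub>F t in sequentially. dist (X t \<omega>) L < r"
        using elim[rule_format, of n]
        by eventually_elim (use n in \<open>unfold dist_real_def, linarith\<close>)
    qed
  qed
  then show thesis by (rule that)
qed

lemma as_lim_eqI:
  assumes "prob_space P" "AE \<omega> in P. (\<lambda>s. Y s \<omega>) \<longlonglongrightarrow> c"
  shows "as_lim P Y = c"
  unfolding as_lim_def
proof (rule the_equality)
  fix c' assume "AE \<omega> in P. (\<lambda>s. Y s \<omega>) \<longlonglongrightarrow> c'"
  with assms(2) have "AE \<omega> in P. c' = c"
    by eventually_elim (rule LIMSEQ_unique)
  then show "c' = c"
    using prob_space.AE_const[OF assms(1)] by blast
qed (use assms in auto)

section \<open>Fields of independent Bernoulli variables\<close>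

lemma expectation_pair_pmf:
  fixes f :: "'a \<times> 'b \<Rightarrow> real"
  assumes "finite (set_pmf A)" "finite (set_pmf B)"
  shows "measure_pmf.expectation (pair_pmf A B) f
    = measure_pmf.expectation A (\<lambda>a. measure_pmf.expectation B (\<lambda>b. f (a, b)))"
proof -
  have "measure_pmf.expectation (pair_pmf A B) f
      = (\<Sum>x\<in>set_pmf A \<times> set_pmf B. f x * pmf (pair_pmf A B) x)"
    using assms by (intro integral_measure_pmf_real) auto
  also have "\<dots> = (\<Sum>(a, b)\<in>set_pmf A \<times> set_pmf B. f (a, b) * pmf B b * pmf A a)"
    by (intro sum.cong) (auto simp: pmf_pair)
  also have "\<dots> = (\<Sum>a\<in>set_pmf A. (\<Sum>b\<in>set_pmf B. f (a, b) * pmf B b) * pmf A a)"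
    by (simp add: sum.cartesian_product[symmetric] sum_distrib_right)
  also have "\<dots> = (\<Sum>a\<in>set_pmf A. measure_pmf.expectation B (\<lambda>b. f (a, b)) * pmf A a)"
    using assms by (subst integral_measure_pmf_real[of "set_pmf B"]) auto
  also have "\<dots> = measure_pmf.expectation A (\<lambda>a. measure_pmf.expectation B (\<lambda>b. f (a, b)))"
    using assms by (intro integral_measure_pmf_real[symmetric]) auto
  finally show ?thesis .
qed

text \<open>
  The law of the field on the finite set \<open>V\<close>. Sites outside \<open>V\<close> carry the default value \<open>False\<close>, so that
  functions of the whole configuration can be integrated against it.
\<close>
definition config_pmf :: "real \<Rightarrow> 'v set \<Rightarrow> ('v \<Rightarrow> bool) pmf" where
  "config_pmf p V = Pi_pmf V False (\<lambda>_. bernoulli_pmf p)"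

definition depends_on :: "'v set \<Rightarrow> (('v \<Rightarrow> bool) \<Rightarrow> 'r) \<Rightarrow> bool" where
  "depends_on V G \<longleftrightarrow> (\<forall>\<omega> \<omega>'. (\<forall>v\<in>V. \<omega> v = \<omega>' v) \<longrightarrow> G \<omega> = G \<omega>')"

definition merge_config :: "'v set \<Rightarrow> ('v \<Rightarrow> bool) \<Rightarrow> ('v \<Rightarrow> bool) \<Rightarrow> 'v \<Rightarrow> bool" where
  "merge_config U x y v = (if v \<in> U then x v else y v)"

lemma finite_set_config_pmf: "finite V \<Longrightarrow> finite (set_pmf (config_pmf p V))"
  unfolding config_pmf_def
  by (rule finite_subset[OF set_Pi_pmf_subset' finite_PiE_dflt]) (auto intro: finite_subset[of _ UNIV])

lemma config_pmf_outside: "finite V \<Longrightarrow> y \<in> set_pmf (config_pmf p V) \<Longrightarrow> v \<notin> V \<Longrightarrow> \<not> y v"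
  unfolding config_pmf_def using set_Pi_pmf_subset[of V False "\<lambda>_. bernoulli_pmf p"] by auto

lemma integrable_config_pmf [simp]:
  fixes G :: "_ \<Rightarrow> real"
  shows "finite V \<Longrightarrow> integrable (measure_pmf (config_pmf p V)) G"
  by (intro integrable_measure_pmf_finite finite_set_config_pmf)

lemma expectation_config_mono:
  fixes F G :: "_ \<Rightarrow> real"
  assumes "finite V" "\<And>y. y \<in> set_pmf (config_pmf p V) \<Longrightarrow> F y \<le> G y"
  shows "measure_pmf.expectation (config_pmf p V) F \<le> measure_pmf.expectation (config_pmf p V) G"
  using assms by (intro integral_mono_AE) (auto simp: AE_measure_pmf_iff)

lemma expectation_config_Un:
  fixes G :: "('v \<Rightarrow> bool) \<Rightarrow> real"
  assumes "finite U" "finite W" "U \<inter> W = {}"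
  shows "measure_pmf.expectation (config_pmf p (U \<union> W)) G
    = measure_pmf.expectation (config_pmf p U) (\<lambda>x.
        measure_pmf.expectation (config_pmf p W) (\<lambda>y. G (merge_config U x y)))"
proof -
  have "config_pmf p (U \<union> W) = map_pmf (\<lambda>(x, y). merge_config U x y)
      (pair_pmf (config_pmf p U) (config_pmf p W))"
    unfolding config_pmf_def using Pi_pmf_union[OF assms, of False "\<lambda>_. bernoulli_pmf p"]
    by (simp add: merge_config_def[abs_def])
  then show ?thesis
    using assms by (simp add: expectation_pair_pmf finite_set_config_pmf case_prod_beta)
qed

text \<open>
  An Efron--Stein type bound, by induction on the number of levels. Let \<open>H\<close> be the mean of \<open>G\<close> over the top
  level, given the others. The variance of \<open>G\<close> is the mean of its conditional variance given the lower
  levels, at most \<open>C\<^sup>2\<close>, plus the variance of \<open>H\<close>, which inherits the bounded differences.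
\<close>
lemma variance_config_bounded_differences:
  fixes G :: "('v \<Rightarrow> bool) \<Rightarrow> real" and lev :: "'v \<Rightarrow> nat"
  assumes "finite V" "\<And>v. v \<in> V \<Longrightarrow> lev v < n"
    and "\<And>\<omega> \<omega>' k. (\<And>v. lev v \<noteq> k \<Longrightarrow> \<omega> v = \<omega>' v) \<Longrightarrow> \<bar>G \<omega> - G \<omega>'\<bar> \<le> C"
  shows "measure_pmf.expectation (config_pmf p V)
    (\<lambda>\<omega>. (G \<omega> - measure_pmf.expectation (config_pmf p V) G)\<^sup>2) \<le> n * C\<^sup>2"
  using assms
proof (induction n arbitrary: V G)
  case 0
  then have "V = {}" by auto
  then show ?case by (simp add: config_pmf_def)
next
  case (Suc n)
  define U W where "U = {v \<in> V. lev v < n}" and "W = {v \<in> V. lev v = n}"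
  have fin: "finite U" "finite W" and disj: "U \<inter> W = {}"
    using Suc.prems(1) by (auto simp: U_def W_def)
  have "lev v < n \<or> lev v = n" if "v \<in> V" for v
    using Suc.prems(2)[OF that] by auto
  then have V: "V = U \<union> W"
    unfolding U_def W_def by blast
  let ?EU = "measure_pmf.expectation (config_pmf p U)"
  let ?EW = "measure_pmf.expectation (config_pmf p W)"
  define H where "H x = ?EW (\<lambda>y. G (merge_config U x y))" for x
  define m where "m = ?EU H"
  have "\<bar>G (\<lambda>_. False) - G (\<lambda>_. False)\<bar> \<le> C" by (rule Suc.prems(3)) (rule refl)
  then have C: "C \<ge> 0" by simp
  have m: "measure_pmf.expectation (config_pmf p V) G = m"
    unfolding m_def H_def V by (rule expectation_config_Un[OF fin disj])
  have H_diff: "\<bar>H \<omega> - H \<omega>'\<bar> \<le> C" if "\<And>v. lev v \<noteq> k \<Longrightarrow> \<omega> v = \<omega>' v" for \<omega> \<omega>' k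
  proof -
    have "\<bar>H \<omega> - H \<omega>'\<bar> = \<bar>?EW (\<lambda>y. G (merge_config U \<omega> y) - G (merge_config U \<omega>' y))\<bar>"
      using fin by (simp add: H_def)
    also have "\<dots> \<le> ?EW (\<lambda>y. \<bar>G (merge_config U \<omega> y) - G (merge_config U \<omega>' y)\<bar>)"
      by (rule integral_abs_bound)
    also have "\<dots> \<le> ?EW (\<lambda>_. C)"
      by (intro expectation_config_mono fin Suc.prems(3)[of k]) (simp add: merge_config_def that)
    finally show ?thesis by simp
  qed
  have inner: "?EW (\<lambda>y. (G (merge_config U x y) - m)\<^sup>2) \<le> C\<^sup>2 + (H x - m)\<^sup>2" for x
  proof -
    let ?g = "\<lambda>y. G (merge_config U x y)"
    have near: "\<bar>?g y - H x\<bar> \<le> C" if y: "y \<in> set_pmf (config_pmf p W)" for y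
    proof -
      have "\<bar>?g y - ?g y'\<bar> \<le> C" if y': "y' \<in> set_pmf (config_pmf p W)" for y'
      proof (rule Suc.prems(3)[of n])
        fix v assume "lev v \<noteq> n"
        then have "v \<notin> W" by (simp add: W_def)
        then show "merge_config U x y v = merge_config U x y' v"
          using config_pmf_outside[OF fin(2) y] config_pmf_outside[OF fin(2) y']
          by (simp add: merge_config_def)
      qed
      then have "?EW (\<lambda>y'. \<bar>?g y - ?g y'\<bar>) \<le> ?EW (\<lambda>_. C)"
        by (intro expectation_config_mono fin)
      moreover have "\<bar>?EW (\<lambda>y'. ?g y - ?g y')\<bar> \<le> ?EW (\<lambda>y'. \<bar>?g y - ?g y'\<bar>)"
        by (rule integral_abs_bound)
      ultimately show ?thesis
        using fin by (simp add: H_def)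
    qed
    have "?EW (\<lambda>y. (?g y - m)\<^sup>2)
        = ?EW (\<lambda>y. (?g y - H x)\<^sup>2 + 2 * (H x - m) * (?g y - H x) + (H x - m)\<^sup>2)"
      by (intro Bochner_Integration.integral_cong refl) (simp add: power2_eq_square algebra_simps)
    also have "\<dots> = ?EW (\<lambda>y. (?g y - H x)\<^sup>2) + 2 * (H x - m) * (H x - H x) + (H x - m)\<^sup>2"
      using fin by (simp add: H_def)
    also have "?EW (\<lambda>y. (?g y - H x)\<^sup>2) \<le> ?EW (\<lambda>_. C\<^sup>2)"
    proof (intro expectation_config_mono fin)
      fix y assume "y \<in> set_pmf (config_pmf p W)"
      then show "(?g y - H x)\<^sup>2 \<le> C\<^sup>2"
        using near by (metis C abs_le_square_iff abs_of_nonneg)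
    qed
    finally show ?thesis by simp
  qed
  have "measure_pmf.expectation (config_pmf p V) (\<lambda>\<omega>. (G \<omega> - m)\<^sup>2)
      = ?EU (\<lambda>x. ?EW (\<lambda>y. (G (merge_config U x y) - m)\<^sup>2))"
    unfolding V by (rule expectation_config_Un[OF fin disj])
  also have "\<dots> \<le> ?EU (\<lambda>x. C\<^sup>2 + (H x - m)\<^sup>2)"
    by (intro expectation_config_mono fin inner)
  also have "\<dots> = C\<^sup>2 + ?EU (\<lambda>x. (H x - m)\<^sup>2)"
    using fin by simp
  also have "?EU (\<lambda>x. (H x - m)\<^sup>2) \<le> n * C\<^sup>2"
    unfolding m_def by (rule Suc.IH[OF fin(1) _ H_diff]) (auto simp: U_def)
  finally show ?case by (simp add: m algebra_simps)
qed

text \<open>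
  Independence is expressed through the finite-dimensional cylinder probabilities, which is the form in
  which it is transferred to the finite product laws \<open>config_pmf\<close>.
\<close>
locale bernoulli_field = prob_space P for P :: "'w measure" +
  fixes Y :: "'v \<Rightarrow> 'w \<Rightarrow> bool" and p :: real
  assumes p_bounds: "0 \<le> p" "p \<le> 1"
    and measurable_site: "{\<omega> \<in> space P. Y v \<omega>} \<in> sets P"
    and cylinder_prob: "finite V \<Longrightarrow>
      measure P {\<omega> \<in> space P. \<forall>v\<in>V. Y v \<omega> = f v} = (\<Prod>v\<in>V. if f v then p else 1 - p)"
begin

lemma cylinder_sets:
  assumes "finite V"
  shows "{\<omega> \<in> space P. \<forall>v\<in>V. Y v \<omega> = f v} \<in> sets P"
proof (rule sets.sets_Collect_finite_All[OF _ assms])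
  fix v
  have "{\<omega> \<in> space P. Y v \<omega> = f v}
      = (if f v then {\<omega> \<in> space P. Y v \<omega>} else space P - {\<omega> \<in> space P. Y v \<omega>})"
    by auto
  then show "{\<omega> \<in> space P. Y v \<omega> = f v} \<in> sets P"
    using measurable_site[of v] by auto
qed

lemma local_function_decomp:
  fixes G :: "('v \<Rightarrow> bool) \<Rightarrow> real"
  assumes "finite V" "depends_on V G" "\<omega> \<in> space P"
  shows "G (\<lambda>v. Y v \<omega>) = (\<Sum>f\<in>PiE_dflt V False (\<lambda>_. UNIV).
    G f * indicator {\<omega> \<in> space P. \<forall>v\<in>V. Y v \<omega> = f v} \<omega>)"
proof -
  define r where "r v = (v \<in> V \<and> Y v \<omega>)" for v
  have r: "r \<in> PiE_dflt V False (\<lambda>_. UNIV)" by (auto simp: PiE_dflt_def r_def)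
  have "(\<Sum>f\<in>PiE_dflt V False (\<lambda>_. UNIV). G f * indicator {\<omega> \<in> space P. \<forall>v\<in>V. Y v \<omega> = f v} \<omega>)
      = (\<Sum>f\<in>PiE_dflt V False (\<lambda>_. UNIV). if f = r then G r else 0)"
  proof (intro sum.cong refl)
    fix f :: "'v \<Rightarrow> bool" assume "f \<in> PiE_dflt V False (\<lambda>_. UNIV)"
    then have "(\<forall>v\<in>V. Y v \<omega> = f v) \<longleftrightarrow> f = r"
      by (auto simp: PiE_dflt_def r_def fun_eq_iff)
    then show "G f * indicator {\<omega> \<in> space P. \<forall>v\<in>V. Y v \<omega> = f v} \<omega> = (if f = r then G r else 0)"
      using assms(3) by (auto simp: indicator_def)
  qed
  also have "\<dots> = G r"
    using r assms(1) by (subst sum.delta) auto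
  also have "\<dots> = G (\<lambda>v. Y v \<omega>)"
    using assms(2) by (auto simp: depends_on_def r_def)
  finally show ?thesis ..
qed

lemma
  fixes G :: "('v \<Rightarrow> bool) \<Rightarrow> real"
  assumes V: "finite V" and G: "depends_on V G"
  shows local_function_integrable: "integrable P (\<lambda>\<omega>. G (\<lambda>v. Y v \<omega>))"
    and local_function_expectation:
      "expectation (\<lambda>\<omega>. G (\<lambda>v. Y v \<omega>)) = measure_pmf.expectation (config_pmf p V) G"
proof -
  let ?I = "\<lambda>f. {\<omega> \<in> space P. \<forall>v\<in>V. Y v \<omega> = f v}"
  let ?S = "\<lambda>\<omega>. \<Sum>f\<in>PiE_dflt V False (\<lambda>_. UNIV). G f * indicator (?I f) \<omega>"
  have int: "integrable P (\<lambda>\<omega>. G f * indicator (?I f) \<omega>)" for f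
    using cylinder_sets[OF V] by (intro integrable_mult_right integrable_real_indicator) (auto simp: emeasure_eq_measure)
  have "integrable P ?S" by (intro Bochner_Integration.integrable_sum int)
  then show "integrable P (\<lambda>\<omega>. G (\<lambda>v. Y v \<omega>))"
    by (subst Bochner_Integration.integrable_cong[OF refl local_function_decomp[OF V G]])
  have "expectation (\<lambda>\<omega>. G (\<lambda>v. Y v \<omega>)) = expectation ?S"
    by (rule Bochner_Integration.integral_cong[OF refl local_function_decomp[OF V G]])
  also have "\<dots> = (\<Sum>f\<in>PiE_dflt V False (\<lambda>_. UNIV). G f * prob (?I f))"
    using cylinder_sets[OF V] int by (subst Bochner_Integration.integral_sum) (auto simp: sets.Int_space_eq2[OF cylinder_sets[OF V]])
  also have "\<dots> = (\<Sum>f\<in>PiE_dflt V False (\<lambda>_. UNIV). G f * pmf (config_pmf p V) f)"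
  proof (intro sum.cong refl arg_cong2[of _ _ _ _ "(*)"])
    fix f :: "'v \<Rightarrow> bool" assume f: "f \<in> PiE_dflt V False (\<lambda>_. UNIV)"
    have "pmf (config_pmf p V) f = (\<Prod>v\<in>V. pmf (bernoulli_pmf p) (f v))"
      unfolding config_pmf_def by (rule pmf_Pi'[OF V]) (use f in \<open>auto simp: PiE_dflt_def\<close>)
    also have "\<dots> = prob (?I f)"
      unfolding cylinder_prob[OF V] using p_bounds by (intro prod.cong refl) auto
    finally show "prob (?I f) = pmf (config_pmf p V) f" ..
  qed
  also have "\<dots> = measure_pmf.expectation (config_pmf p V) G"
    using V set_Pi_pmf_subset'[OF V, of False "\<lambda>_. bernoulli_pmf p"]
    by (intro integral_measure_pmf_real[symmetric] finite_PiE_dflt V)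
      (auto simp: config_pmf_def PiE_dflt_def)
  finally show "expectation (\<lambda>\<omega>. G (\<lambda>v. Y v \<omega>)) = measure_pmf.expectation (config_pmf p V) G" .
qed

text \<open>
  For \<open>h\<close> a translation this is the stationarity of the environment.
\<close>
lemma bernoulli_field_reindex:
  fixes h :: "'u \<Rightarrow> 'v"
  assumes "inj h"
  shows "bernoulli_field P (\<lambda>u. Y (h u)) p"
proof unfold_locales
  fix V :: "'u set" and f :: "'u \<Rightarrow> bool" assume "finite V"
  have "{\<omega> \<in> space P. \<forall>u\<in>V. Y (h u) \<omega> = f u} = {\<omega> \<in> space P. \<forall>v\<in>h ` V. Y v \<omega> = f (inv h v)}"
    using assms by auto
  then show "prob {\<omega> \<in> space P. \<forall>u\<in>V. Y (h u) \<omega> = f u} = (\<Prod>u\<in>V. if f u then p else 1 - p)"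
    using cylinder_prob[of "h ` V" "\<lambda>v. f (inv h v)"] \<open>finite V\<close> assms
    by (simp add: prod.reindex inj_on_subset[OF assms])
qed (use p_bounds measurable_site in auto)

end

lemma bernoulli_field_of_indep_vars:
  fixes X :: "'v \<Rightarrow> 'w \<Rightarrow> real"
  assumes "prob_space P" "prob_space.indep_vars P (\<lambda>_. borel) X UNIV"
    and prob: "\<And>v. measure P {\<omega> \<in> space P. X v \<omega> = c} = p"
  shows "bernoulli_field P (\<lambda>v \<omega>. X v \<omega> = c) p"
proof -
  interpret prob_space P by fact
  have [measurable]: "X v \<in> borel_measurable P" for v
    using assms(2) by (auto simp: indep_vars_def2)
  have compl: "prob {\<omega> \<in> space P. X v \<omega> \<noteq> c} = 1 - p" for v
    using prob_neg[of "\<lambda>\<omega>. X v \<omega> = c"] prob[of v] by auto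
  show ?thesis
  proof unfold_locales
    fix V :: "'v set" and f :: "'v \<Rightarrow> bool" assume V: "finite V"
    define A where "A v = (if f v then {c} else - {c})" for v
    show "prob {\<omega> \<in> space P. \<forall>v\<in>V. (X v \<omega> = c) = f v} = (\<Prod>v\<in>V. if f v then p else 1 - p)"
    proof (cases "V = {}")
      case True
      then show ?thesis by (simp add: prob_space)
    next
      case False
      have "{\<omega> \<in> space P. \<forall>v\<in>V. (X v \<omega> = c) = f v} = (\<Inter>v\<in>V. X v -` A v \<inter> space P)"
        using False by (auto simp: A_def split: if_splits)
      also have "prob \<dots> = (\<Prod>v\<in>V. prob (X v -` A v \<inter> space P))"
        by (rule indep_varsD[OF assms(2) False V]) (auto simp: A_def)
      also have "\<dots> = (\<Prod>v\<in>V. if f v then p else 1 - p)"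
      proof (intro prod.cong refl)
        fix v
        have "X v -` A v \<inter> space P
            = (if f v then {\<omega> \<in> space P. X v \<omega> = c} else {\<omega> \<in> space P. X v \<omega> \<noteq> c})"
          by (auto simp: A_def)
        then show "prob (X v -` A v \<inter> space P) = (if f v then p else 1 - p)"
          by (simp add: prob compl)
      qed
      finally show ?thesis .
    qed
  qed (use prob[of undefined] prob_le_1 in auto)
qed

section \<open>Almost sure limit of the free energy\<close>

text \<open>
  A finite set containing every site that can influence the paths of length up to \<open>n\<close>.
\<close>
definition reach :: "nat \<Rightarrow> 'd::finite vertex set" where
  "reach n = (\<Union>k\<le>n. \<Union>(set ` origin_paths k))"

lemma finite_reach: "finite (reach n)"
  by (auto simp: reach_def finite_origin_paths)

lemma nth_in_reach: "\<pi> \<in> origin_paths s \<Longrightarrow> s \<le> n \<Longrightarrow> i \<le> s \<Longrightarrow> \<pi> ! i \<in> reach n"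
  unfolding reach_def using origin_paths_length[of \<pi> s] nth_mem[of i \<pi>] by force

lemma heavy_cong:
  assumes "\<pi> \<in> origin_paths t" "\<And>i. 1 \<le> i \<Longrightarrow> i \<le> t \<Longrightarrow> \<omega> (\<pi> ! i) = \<omega>' (\<pi> ! i)"
  shows "heavy \<omega> \<pi> = heavy \<omega>' \<pi>"
  unfolding heavy_def using assms by (intro sum.cong) (auto simp: origin_paths_length)

lemma free_energy_cong:
  assumes "\<And>\<pi> i. \<pi> \<in> origin_paths t \<Longrightarrow> 1 \<le> i \<Longrightarrow> i \<le> t \<Longrightarrow> \<omega> (\<pi> ! i) = \<omega>' (\<pi> ! i)"
  shows "soft_count B a t \<omega> = soft_count B a t \<omega>'" "free_energy B a t \<omega> = free_energy B a t \<omega>'"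
proof -
  show "soft_count B a t \<omega> = soft_count B a t \<omega>'"
    unfolding soft_count_def by (intro sum.cong refl) (use assms heavy_cong in metis)
  then show "free_energy B a t \<omega> = free_energy B a t \<omega>'" by (simp add: free_energy_def)
qed

lemma depends_on_free_energy: "depends_on (reach t) (free_energy B a t)"
  unfolding depends_on_def by (auto intro!: free_energy_cong nth_in_reach)

text \<open>
  A path visits each level at most once, so a change on one level changes its weight by at most \<open>1\<close>.
\<close>
lemma free_energy_level_difference:
  assumes "B \<ge> 0" "\<And>v. snd v \<noteq> k \<Longrightarrow> \<omega> v = \<omega>' v"
  shows "\<bar>free_energy B a t \<omega> - free_energy B a t \<omega>'\<bar> \<le> B"
proof (rule abs_free_energy_diff_le[OF assms(1)])
  fix \<pi> :: "'a vertex list" assume \<pi>: "\<pi> \<in> origin_paths t"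
  have one_sided: "heavy \<xi> \<pi> \<le> heavy \<xi>' \<pi> + 1" if "\<And>v. snd v \<noteq> k \<Longrightarrow> \<xi> v = \<xi>' v"
    for \<xi> \<xi>' :: "'a vertex \<Rightarrow> bool"
  proof -
    have "heavy \<xi> \<pi> \<le> (\<Sum>i = 1..<length \<pi>. of_bool (\<xi>' (\<pi> ! i)) + (if i = k then 1 else 0))"
      unfolding heavy_def
    proof (intro sum_mono)
      fix i assume "i \<in> {1..<length \<pi>}"
      then have "snd (\<pi> ! i) = i" using \<pi> by (simp add: origin_paths_length origin_paths_snd)
      then show "of_bool (\<xi> (\<pi> ! i)) \<le> of_bool (\<xi>' (\<pi> ! i)) + (if i = k then 1 else (0::nat))"
        using that[of "\<pi> ! i"] by auto
    qed
    also have "\<dots> \<le> heavy \<xi>' \<pi> + 1"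
      by (simp add: sum.distrib heavy_def sum.delta)
    finally show ?thesis .
  qed
  show "\<bar>real (heavy \<omega> \<pi>) - real (heavy \<omega>' \<pi>)\<bar> \<le> 1"
    using one_sided[of \<omega> \<omega>'] one_sided[of \<omega>' \<omega>] assms(2) by auto
qed

locale percolation = bernoulli_field P Y p
  for P :: "'w measure" and Y :: "'d::finite vertex \<Rightarrow> 'w \<Rightarrow> bool" and p
begin

abbreviation env :: "'w \<Rightarrow> 'd vertex \<Rightarrow> bool" where "env \<omega> \<equiv> (\<lambda>v. Y v \<omega>)"

definition mean_energy :: "real \<Rightarrow> real \<Rightarrow> nat \<Rightarrow> real" where
  "mean_energy B a t = expectation (\<lambda>\<omega>. free_energy B a t (env \<omega>))"

lemma integrable_free_energy: "integrable P (\<lambda>\<omega>. free_energy B a t (env \<omega>))"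
  by (rule local_function_integrable[OF finite_reach depends_on_free_energy])

lemma mean_energy_config:
  "mean_energy B a t = measure_pmf.expectation (config_pmf p (reach t :: 'd vertex set)) (free_energy B a t)"
  unfolding mean_energy_def by (rule local_function_expectation[OF finite_reach depends_on_free_energy])

lemma mean_energy_shifted:
  fixes v :: "'d vertex"
  assumes "finite W" "depends_on W (\<lambda>y. free_energy B a t (\<lambda>u. y (v + u)))"
  shows "measure_pmf.expectation (config_pmf p W) (\<lambda>y. free_energy B a t (\<lambda>u. y (v + u)))
    = mean_energy B a t"
proof -
  interpret shifted: bernoulli_field P "\<lambda>u. Y (v + u)" p
    by (rule bernoulli_field_reindex) (simp add: inj_def)
  show ?thesis
    using local_function_expectation[OF assms]
      shifted.local_function_expectation[OF finite_reach depends_on_free_energy, of B a t]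
    by (simp add: mean_energy_config)
qed

text \<open>
  The sites up to time \<open>s\<close> determine the first part of the path and its Gibbs weights, the later sites
  determine the free energies seen from the endpoints. Averaging over the later sites first replaces each
  of these by \<open>mean_energy B a' t\<close>, and the Gibbs weights sum to \<open>1\<close>.
\<close>
lemma mean_energy_superadditive:
  assumes B: "B \<ge> 0"
  shows "mean_energy B a s + mean_energy B a' t \<le> mean_energy B (a + a') (s + t)"
proof -
  define U W :: "'d vertex set"
    where "U = {v \<in> reach (s + t). snd v \<le> s}" and "W = {v \<in> reach (s + t). s < snd v}"
  have R: "reach (s + t) = U \<union> W" and fin: "finite U" "finite W" and disj: "U \<inter> W = {}"
    using finite_reach[of "s + t"] by (auto simp: U_def W_def)
  let ?EU = "measure_pmf.expectation (config_pmf p U)"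
  let ?EW = "measure_pmf.expectation (config_pmf p W)"
  let ?S = "\<lambda>\<pi> y. free_energy B a' t (\<lambda>u. y (last \<pi> + u))"
  have in_U: "\<pi> ! i \<in> U" if "\<pi> \<in> origin_paths s" "i \<le> s" for \<pi> i
    using that by (auto simp: U_def origin_paths_snd intro: nth_in_reach)
  have in_W: "last \<pi> + \<rho> ! i \<in> W"
    if "\<pi> \<in> origin_paths s" "\<rho> \<in> origin_paths t" "1 \<le> i" "i \<le> t" for \<pi> \<rho> i
    using nth_glue_right[OF that(1,2,4)] nth_in_reach[OF glue_in_origin_paths[OF that(1,2)], of "s + t" "s + i"]
      origin_paths_snd[OF glue_in_origin_paths[OF that(1,2)], of "s + i"] that(3,4)
    by (simp add: W_def)
  have dep_U: "free_energy B a s \<omega> = free_energy B a s \<omega>'"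
    "\<pi> \<in> origin_paths s \<Longrightarrow> gibbs_weight B a s \<omega> \<pi> = gibbs_weight B a s \<omega>' \<pi>"
    if "\<And>v. v \<in> U \<Longrightarrow> \<omega> v = \<omega>' v" for \<omega> \<omega>' \<pi>
  proof -
    have *: "\<omega> (\<pi> ! i) = \<omega>' (\<pi> ! i)" if "\<pi> \<in> origin_paths s" "1 \<le> i" "i \<le> s" for \<pi> i
      using that in_U \<open>\<And>v. v \<in> U \<Longrightarrow> \<omega> v = \<omega>' v\<close> by blast
    show "free_energy B a s \<omega> = free_energy B a s \<omega>'" using * by (rule free_energy_cong(2))
    show "gibbs_weight B a s \<omega> \<pi> = gibbs_weight B a s \<omega>' \<pi>" if \<pi>: "\<pi> \<in> origin_paths s"
    proof -
      have "heavy \<omega> \<pi> = heavy \<omega>' \<pi>" using \<pi> *[OF \<pi>] by (rule heavy_cong)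
      moreover have "soft_count B a s \<omega> = soft_count B a s \<omega>'" using * by (rule free_energy_cong(1))
      ultimately show ?thesis by (simp add: gibbs_weight_def)
    qed
  qed
  have dep_W: "depends_on W (?S \<pi>)" if "\<pi> \<in> origin_paths s" for \<pi>
    unfolding depends_on_def by (auto intro!: free_energy_cong in_W[OF that])
  have "free_energy B a s x + mean_energy B a' t
      \<le> ?EW (\<lambda>y. free_energy B (a + a') (s + t) (merge_config U x y))" for x
  proof -
    have fe: "free_energy B a s (merge_config U x y) = free_energy B a s x"
      and gw: "\<And>\<pi>. \<pi> \<in> origin_paths s \<Longrightarrow>
        gibbs_weight B a s (merge_config U x y) \<pi> = gibbs_weight B a s x \<pi>" for y
      by (auto intro!: dep_U simp: merge_config_def)
    have sh: "?S \<pi> (merge_config U x y) = ?S \<pi> y" if "\<pi> \<in> origin_paths s" for \<pi> y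
    proof -
      have "\<forall>v\<in>W. merge_config U x y v = y v" using disj by (auto simp: merge_config_def)
      then show ?thesis using dep_W[OF that] unfolding depends_on_def by blast
    qed
    have "free_energy B a s x + mean_energy B a' t = free_energy B a s x
        + (\<Sum>\<pi>\<in>origin_paths s. gibbs_weight B a s x \<pi> * ?EW (?S \<pi>))"
      using mean_energy_shifted[OF fin(2) dep_W] sum_gibbs_weight[of B a s x]
      by (simp flip: sum_distrib_right)
    also have "\<dots> = ?EW (\<lambda>y. free_energy B a s x
        + (\<Sum>\<pi>\<in>origin_paths s. gibbs_weight B a s x \<pi> * ?S \<pi> y))"
      using fin by simp
    also have "\<dots> \<le> ?EW (\<lambda>y. free_energy B (a + a') (s + t) (merge_config U x y))"
    proof (intro expectation_config_mono fin)
      fix y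
      show "free_energy B a s x + (\<Sum>\<pi>\<in>origin_paths s. gibbs_weight B a s x \<pi> * ?S \<pi> y)
          \<le> free_energy B (a + a') (s + t) (merge_config U x y)"
        using free_energy_superadditive[OF B, where ?\<omega> = "merge_config U x y" and a = a and a' = a' and s = s and t = t]
        by (simp add: fe gw sh)
    qed
    finally show ?thesis .
  qed
  then have "?EU (\<lambda>x. free_energy B a s x + mean_energy B a' t)
      \<le> ?EU (\<lambda>x. ?EW (\<lambda>y. free_energy B (a + a') (s + t) (merge_config U x y)))"
    by (intro expectation_config_mono fin)
  moreover have "?EU (free_energy B a s) = mean_energy B a s"
    unfolding mean_energy_def
    by (rule local_function_expectation[symmetric, OF fin(1)]) (auto simp: depends_on_def intro: dep_U)
  ultimately show ?thesis
    using fin by (simp add: mean_energy_config[of B "a + a'"] R expectation_config_Un[OF fin disj])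
qed

lemma abs_mean_energy_le:
  assumes "B \<ge> 0" "a \<ge> 0"
  shows "\<bar>mean_energy B a t\<bar> \<le> t * ln (branching TYPE('d)) + B * a"
proof -
  have "\<bar>mean_energy B a t\<bar> \<le> expectation (\<lambda>\<omega>. \<bar>free_energy B a t (env \<omega>)\<bar>)"
    unfolding mean_energy_def by (rule integral_abs_bound)
  also have "\<dots> \<le> expectation (\<lambda>\<omega>. t * ln (branching TYPE('d)) + B * a)"
    using integrable_free_energy abs_free_energy_le[OF assms, where ?'d = 'd]
    by (intro integral_mono) auto
  finally show ?thesis by (simp add: prob_space)
qed

definition energy_density :: "real \<Rightarrow> real \<Rightarrow> real" where
  "energy_density B \<alpha> = lim (\<lambda>t. mean_energy B (\<alpha> * real t) t / t)"

lemma mean_energy_tendsto: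
  assumes "B \<ge> 0" "\<alpha> \<ge> 0"
  shows "(\<lambda>t. mean_energy B (\<alpha> * real t) t / t) \<longlonglongrightarrow> energy_density B \<alpha>"
proof -
  have "convergent (\<lambda>t. mean_energy B (\<alpha> * real t) t / t)"
  proof (rule superadditive_imp_convergent)
    show "mean_energy B (\<alpha> * real s) s + mean_energy B (\<alpha> * real t) t \<le> mean_energy B (\<alpha> * real (s + t)) (s + t)"
      for s t :: nat
      using mean_energy_superadditive[OF assms(1), of "\<alpha> * real s" s "\<alpha> * real t" t] by (simp add: distrib_left)
    show "\<bar>mean_energy B (\<alpha> * real t) t\<bar> \<le> (ln (branching TYPE('d)) + B * \<alpha>) * t" for t :: nat
      using abs_mean_energy_le[OF assms(1), of "\<alpha> * real t" t] assms(2) by (simp add: algebra_simps)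
  qed
  then show ?thesis unfolding energy_density_def by (simp add: convergent_LIMSEQ_iff)
qed

lemma variance_free_energy:
  assumes "B \<ge> 0"
  shows "variance (\<lambda>\<omega>. free_energy B a t (env \<omega>)) \<le> real (t + 1) * B\<^sup>2"
    and "integrable P (\<lambda>\<omega>. (free_energy B a t (env \<omega>) - mean_energy B a t)\<^sup>2)"
proof -
  let ?m = "measure_pmf.expectation (config_pmf p (reach t :: 'd vertex set)) (free_energy B a t)"
  have dep: "depends_on (reach t :: 'd vertex set) (\<lambda>x. (free_energy B a t x - c)\<^sup>2)" for c
    using depends_on_free_energy[of t B a] unfolding depends_on_def by metis
  have "snd v < t + 1" if "v \<in> reach t" for v :: "'d vertex"
    using that unfolding reach_def
    by (auto simp: in_set_conv_nth origin_paths_length origin_paths_snd)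
  then have "measure_pmf.expectation (config_pmf p (reach t :: 'd vertex set)) (\<lambda>x. (free_energy B a t x - ?m)\<^sup>2)
      \<le> real (t + 1) * B\<^sup>2"
    using variance_config_bounded_differences[OF finite_reach, where lev = snd and n = "t + 1"
        and G = "free_energy B a t :: ('d vertex \<Rightarrow> bool) \<Rightarrow> real" and C = B]
      free_energy_level_difference[OF assms, where ?'a = 'd] by blast
  then show "variance (\<lambda>\<omega>. free_energy B a t (env \<omega>)) \<le> real (t + 1) * B\<^sup>2"
    using local_function_expectation[OF finite_reach dep[of ?m]]
    by (simp add: mean_energy_config flip: mean_energy_def)
  show "integrable P (\<lambda>\<omega>. (free_energy B a t (env \<omega>) - mean_energy B a t)\<^sup>2)"
    by (rule local_function_integrable[OF finite_reach dep])
qed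

text \<open>
  The variance at time \<open>n\<^sup>2\<close>, divided by \<open>n\<^sup>4\<close>, is summable, so the centred free energy is negligible along
  squares; the bounded increments extend this to all times.
\<close>
lemma free_energy_tendsto_AE:
  assumes "B \<ge> 0" "\<alpha> \<ge> 0"
  shows "AE \<omega> in P. (\<lambda>t. free_energy B (\<alpha> * real t) t (env \<omega>) / t) \<longlonglongrightarrow> energy_density B \<alpha>"
proof -
  define D where "D t \<omega> = free_energy B (\<alpha> * real t) t (env \<omega>) - mean_energy B (\<alpha> * real t) t" for t :: nat and \<omega>
  have int: "integrable P (D t)" for t
    unfolding D_def using integrable_free_energy by auto
  let ?X = "\<lambda>n \<omega>. D (n\<^sup>2) \<omega> / real (n\<^sup>2)"
  have "AE \<omega> in P. (\<lambda>n. ?X n \<omega>) \<longlonglongrightarrow> 0"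
  proof (rule AE_tendsto_0_of_summable_second_moment)
    show "?X n \<in> borel_measurable P" for n
      using int[of "n\<^sup>2"] by (intro borel_measurable_divide) auto
    have eq: "(?X n \<omega>)\<^sup>2 = (D (n\<^sup>2) \<omega>)\<^sup>2 / real n ^ 4" for n \<omega>
      by (simp add: power_divide)
    show "integrable P (\<lambda>\<omega>. (?X n \<omega>)\<^sup>2)" for n
      unfolding eq unfolding D_def using variance_free_energy(2)[OF assms(1)] by simp
    show "expectation (\<lambda>\<omega>. (?X n \<omega>)\<^sup>2) \<le> 2 * B\<^sup>2 * inverse (real n ^ 2)" for n
    proof (cases "n = 0")
      case False
      have "expectation (\<lambda>\<omega>. (D (n\<^sup>2) \<omega>)\<^sup>2) \<le> (n\<^sup>2 + 1) * B\<^sup>2"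
        using variance_free_energy(1)[OF assms(1), of "\<alpha> * real (n\<^sup>2)" "n\<^sup>2"]
        by (simp add: D_def mean_energy_def add.commute)
      also have "\<dots> \<le> (2 * n\<^sup>2) * B\<^sup>2"
      proof (intro mult_right_mono)
        have "n\<^sup>2 + 1 \<le> 2 * n\<^sup>2" using False by (simp add: Suc_le_eq)
        then show "real (n\<^sup>2 + 1) \<le> real (2 * n\<^sup>2)" by (simp only: of_nat_le_iff)
      qed simp
      finally have "expectation (\<lambda>\<omega>. (D (n\<^sup>2) \<omega>)\<^sup>2) / real n ^ 4 \<le> (2 * n\<^sup>2) * B\<^sup>2 / real n ^ 4"
        by (intro divide_right_mono) auto
      also have "\<dots> = 2 * B\<^sup>2 * inverse (real n ^ 2)"
        using False by (simp add: field_simps power_numeral_reduce)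
      finally show ?thesis unfolding eq by simp
    qed simp
    show "summable (\<lambda>n. 2 * B\<^sup>2 * inverse (real n ^ 2))"
      by (intro summable_mult inverse_power_summable) simp
  qed
  then show ?thesis
  proof eventually_elim
    case (elim \<omega>)
    define c where "c = ln (branching TYPE('d)) + B * (1 + \<alpha>)"
    have step: "\<bar>mean_energy B (\<alpha> * real (Suc t)) (Suc t) - mean_energy B (\<alpha> * real t) t\<bar> \<le> c" for t :: nat
    proof -
      have "\<bar>mean_energy B (\<alpha> * real (Suc t)) (Suc t) - mean_energy B (\<alpha> * real t) t\<bar>
          = \<bar>expectation (\<lambda>\<omega>. free_energy B (\<alpha> * real (Suc t)) (Suc t) (env \<omega>) - free_energy B (\<alpha> * real t) t (env \<omega>))\<bar>"
        unfolding mean_energy_def using integrable_free_energy by (subst Bochner_Integration.integral_diff) auto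
      also have "\<dots> \<le> expectation (\<lambda>\<omega>. \<bar>free_energy B (\<alpha> * real (Suc t)) (Suc t) (env \<omega>) - free_energy B (\<alpha> * real t) t (env \<omega>)\<bar>)"
        by (rule integral_abs_bound)
      also have "\<dots> \<le> expectation (\<lambda>\<omega>. c)"
        using integrable_free_energy free_energy_step[OF assms, where ?'d = 'd, folded c_def]
        by (intro integral_mono) auto
      finally show ?thesis by (simp add: prob_space)
    qed
    have "\<bar>D (Suc t) \<omega> - D t \<omega>\<bar> \<le> 2 * c" for t
      using step[of t] free_energy_step[OF assms, of t "env \<omega>", folded c_def] unfolding D_def by linarith
    then have "(\<lambda>t. D t \<omega> / t) \<longlonglongrightarrow> 0"
      by (rule lipschitz_ratio_tendsto_0[OF _ elim])
    from tendsto_add[OF this mean_energy_tendsto[OF assms]] show ?case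
      by (simp add: D_def flip: add_divide_distrib)
  qed
qed

end

section \<open>Concavity and the growth rate\<close>

context percolation
begin

text \<open>
  Superadditivity for a stretch of length \<open>n m\<close> with density \<open>\<alpha>\<close> followed by one of length \<open>m\<close> with density
  \<open>\<gamma>\<close>, divided by \<open>m\<close>, in the limit of large \<open>m\<close>. Weights of the form \<open>n / (n + 1)\<close> are enough both to
  approach \<open>\<alpha>\<close> from above and to interpolate between \<open>0\<close> and a density below \<open>M\<close>.
\<close>
lemma energy_density_concave:
  assumes B: "B \<ge> 0" and "\<alpha> \<ge> 0" "\<gamma> \<ge> 0" and n: "n \<ge> 1"
  shows "(real n * energy_density B \<alpha> + energy_density B \<gamma>) / real (n + 1)
    \<le> energy_density B ((real n * \<alpha> + \<gamma>) / real (n + 1))"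
proof -
  define \<delta> where "\<delta> = (real n * \<alpha> + \<gamma>) / real (n + 1)"
  have \<delta>: "\<delta> \<ge> 0" "real (n + 1) * \<delta> = real n * \<alpha> + \<gamma>" using assms by (auto simp: \<delta>_def)
  have multiple: "(\<lambda>m. mean_energy B (\<theta> * real (k * m)) (k * m) / m) \<longlonglongrightarrow> real k * energy_density B \<theta>"
    if "\<theta> \<ge> 0" "k \<ge> 1" for \<theta> k
  proof -
    have "strict_mono (\<lambda>m. k * m)" using that by (simp add: strict_mono_def)
    from LIMSEQ_subseq_LIMSEQ[OF mean_energy_tendsto[OF B that(1)] this]
    have "(\<lambda>m. real k * (mean_energy B (\<theta> * real (k * m)) (k * m) / real (k * m))) \<longlonglongrightarrow> real k * energy_density B \<theta>"
      by (intro tendsto_mult tendsto_const) (simp add: o_def)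
    then show ?thesis using that by simp
  qed
  have "real n * energy_density B \<alpha> + energy_density B \<gamma> \<le> real (n + 1) * energy_density B \<delta>"
  proof (rule LIMSEQ_le)
    show "(\<lambda>m. mean_energy B (\<alpha> * real (n * m)) (n * m) / m + mean_energy B (\<gamma> * real m) m / m)
        \<longlonglongrightarrow> real n * energy_density B \<alpha> + energy_density B \<gamma>"
      using assms by (intro tendsto_add multiple mean_energy_tendsto)
    show "(\<lambda>m. mean_energy B (\<delta> * real ((n + 1) * m)) ((n + 1) * m) / m) \<longlonglongrightarrow> real (n + 1) * energy_density B \<delta>"
      using \<delta> by (intro multiple) auto
    have "mean_energy B (\<alpha> * real (n * m)) (n * m) / m + mean_energy B (\<gamma> * real m) m / m
        \<le> mean_energy B (\<delta> * real ((n + 1) * m)) ((n + 1) * m) / m" for m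
    proof -
      have "\<delta> * real ((n + 1) * m) = (real (n + 1) * \<delta>) * m" by (simp only: of_nat_mult mult_ac)
      also have "\<dots> = \<alpha> * real (n * m) + \<gamma> * real m" unfolding \<delta>(2) by (simp add: algebra_simps)
      finally show ?thesis
        using mean_energy_superadditive[OF B, of "\<alpha> * real (n * m)" "n * m" "\<gamma> * real m" m]
        by (simp add: add.commute divide_right_mono flip: add_divide_distrib)
    qed
    then show "\<exists>N. \<forall>m\<ge>N. mean_energy B (\<alpha> * real (n * m)) (n * m) / m + mean_energy B (\<gamma> * real m) m / m
        \<le> mean_energy B (\<delta> * real ((n + 1) * m)) ((n + 1) * m) / m" by blast
  qed
  then show ?thesis unfolding \<delta>_def[symmetric] by (simp add: field_simps)
qed

lemma energy_density_le:
  assumes "B \<ge> 0" "\<alpha> \<ge> 0"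
  shows "energy_density B \<alpha> \<le> ln (branching TYPE('d))"
proof -
  have "AE \<omega> in P. energy_density B \<alpha> \<le> ln (branching TYPE('d))"
    using free_energy_tendsto_AE[OF assms]
  proof eventually_elim
    case (elim \<omega>)
    have "free_energy B (\<alpha> * real t) t (env \<omega>) / t \<le> ln (branching TYPE('d))" for t :: nat
      using free_energy_le[OF assms(1), of "\<alpha> * real t" t "env \<omega>"] ln_branching_pos[where ?'d = 'd]
      by (cases "t = 0") (auto simp: field_simps)
    then show ?case by (intro LIMSEQ_le_const2[OF elim]) auto
  qed
  then show ?thesis by simp
qed

lemma energy_density_0:
  assumes "B \<ge> 0"
  shows "energy_density B 0 = ln (branching TYPE('d))"
proof (rule LIMSEQ_unique)
  show "(\<lambda>t. mean_energy B (0 * real t) t / t) \<longlonglongrightarrow> energy_density B 0"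
    using assms by (intro mean_energy_tendsto) auto
  have "mean_energy B 0 t = t * ln (branching TYPE('d))" for t
    by (simp add: mean_energy_def free_energy_0 prob_space)
  then show "(\<lambda>t. mean_energy B (0 * real t) t / t) \<longlonglongrightarrow> ln (branching TYPE('d))"
    by (intro tendsto_eventually, use eventually_gt_at_top[of 0] in eventually_elim) simp
qed

definition max_fraction :: "nat \<Rightarrow> 'w \<Rightarrow> real" where
  "max_fraction t \<omega> = (MAX \<pi>\<in>origin_paths t. (1 / real t) * real (heavy (env \<omega>) \<pi>))"

lemma max_fraction_tendsto_AE:
  obtains M where "AE \<omega> in P. (\<lambda>t. max_fraction t \<omega>) \<longlonglongrightarrow> M"
proof (rule AE_tendsto_const_of_approx)
  fix n :: nat
  define B where "B = real (Suc n)"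
  have B: "B > 0" by (simp add: B_def)
  have "AE \<omega> in P. (\<lambda>t. free_energy B (1 * real t) t (env \<omega>) / t) \<longlonglongrightarrow> energy_density B 1"
    using B by (intro free_energy_tendsto_AE) auto
  then show "AE \<omega> in P. \<forall>\<^sub>F t in sequentially. \<bar>max_fraction t \<omega> - (energy_density (real (Suc n)) 1 / real (Suc n) + 1)\<bar>
      \<le> (ln (branching TYPE('d)) + 1) / real (Suc n)"
    unfolding B_def[symmetric]
  proof eventually_elim
    case (elim \<omega>)
    have "(\<lambda>t. free_energy B (1 * real t) t (env \<omega>) / t / B + 1) \<longlonglongrightarrow> energy_density B 1 / B + 1"
      using B by (intro tendsto_intros elim) auto
    then have "\<forall>\<^sub>F t in sequentially. dist (free_energy B (1 * real t) t (env \<omega>) / t / B + 1)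
        (energy_density B 1 / B + 1) < 1 / B"
      using B by (intro tendstoD) auto
    then show ?case
      using eventually_gt_at_top[of 0]
    proof eventually_elim
      case (elim t)
      define y where "y = free_energy B (real t) t (env \<omega>) / (real t * B) + 1"
      have "\<bar>y - (energy_density B 1 / B + 1)\<bar> < 1 / B"
        using elim(1) by (simp add: y_def dist_real_def)
      moreover have "\<bar>max_fraction t \<omega> - y\<bar> \<le> ln (branching TYPE('d)) / B"
        unfolding y_def max_fraction_def using B elim(2) by (rule max_heavy_vs_free_energy)
      ultimately show ?case unfolding add_divide_distrib by linarith
    qed
  qed
next
  show "(\<lambda>n. (ln (branching TYPE('d)) + 1) / real (Suc n)) \<longlonglongrightarrow> 0"
    by (rule LIMSEQ_Suc[OF lim_const_over_n])
qed (rule that)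

lemma eventually_hard_count_pos:
  assumes lim: "(\<lambda>t. max_fraction t \<omega>) \<longlonglongrightarrow> M" and "\<gamma> < M"
  shows "\<forall>\<^sub>F t in sequentially. hard_count (\<gamma> * real t) t (env \<omega>) \<ge> 1"
  using order_tendstoD(1)[OF assms] eventually_gt_at_top[of 0]
proof eventually_elim
  case (elim t)
  let ?f = "\<lambda>\<pi>. (1 / real t) * real (heavy (env \<omega>) \<pi>)"
  have "max_fraction t \<omega> \<in> ?f ` origin_paths t"
    unfolding max_fraction_def by (intro Max_in finite_imageI finite_origin_paths) (simp add: origin_paths_nonempty)
  then obtain \<pi> where \<pi>: "\<pi> \<in> origin_paths t" "max_fraction t \<omega> = ?f \<pi>" by blast
  have "\<gamma> * real t \<le> max_fraction t \<omega> * real t"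
    using elim by (intro mult_right_mono) auto
  then have "\<pi> \<in> {\<pi> \<in> origin_paths t. \<gamma> * real t \<le> real (heavy (env \<omega>) \<pi>)}"
    using elim(2) \<pi> by simp
  then have "hard_count (\<gamma> * real t) t (env \<omega>) > 0"
    unfolding hard_count_def card_gt_0_iff
    by (intro conjI finite_subset[OF _ finite_origin_paths[of t]]) auto
  then show ?case by simp
qed

text \<open>
  Below \<open>M\<close> some path reaches the threshold and contributes \<open>1\<close> to the soft count.
\<close>
lemma energy_density_nonneg:
  assumes "AE \<omega> in P. (\<lambda>t. max_fraction t \<omega>) \<longlonglongrightarrow> M" "0 \<le> \<gamma>" "\<gamma> < M" "B \<ge> 0"
  shows "energy_density B \<gamma> \<ge> 0"
proof -
  have "AE \<omega> in P. 0 \<le> energy_density B \<gamma>"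
    using free_energy_tendsto_AE[OF assms(4,2)] assms(1)
  proof eventually_elim
    case (elim \<omega>)
    have "\<forall>\<^sub>F t in sequentially. 0 \<le> free_energy B (\<gamma> * real t) t (env \<omega>) / t"
      using eventually_hard_count_pos[OF elim(2) assms(3)]
    proof eventually_elim
      case (elim t)
      then have "1 \<le> soft_count B (\<gamma> * real t) t (env \<omega>)"
        using hard_count_le_soft_count[of "\<gamma> * real t" t "env \<omega>" B] by linarith
      then show ?case by (simp add: free_energy_def)
    qed
    then show ?case by (rule tendsto_lowerbound[OF elim(1)]) simp
  qed
  then show ?thesis by simp
qed

text \<open>
  The choice of \<open>B\<close> makes the paths of density below \<open>\<alpha>\<close> negligible in the soft count with
  threshold \<open>\<alpha>' t\<close>.
\<close>
lemma hard_count_bounds_AE: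
  assumes M: "AE \<omega> in P. (\<lambda>t. max_fraction t \<omega>) \<longlonglongrightarrow> M" and \<alpha>: "0 \<le> \<alpha>" "\<alpha> < M" "\<alpha> < \<alpha>'"
    and B: "B = ln (branching TYPE('d)) / (\<alpha>' - \<alpha>)" and "r > 0"
  shows "AE \<omega> in P. \<forall>\<^sub>F t in sequentially.
    energy_density B \<alpha>' - r \<le> ln (hard_count (\<alpha> * real t) t (env \<omega>)) / t \<and>
    ln (hard_count (\<alpha> * real t) t (env \<omega>)) / t \<le> energy_density B \<alpha> + r"
proof -
  have B0: "B \<ge> 0" and B_mult: "B * (\<alpha>' - \<alpha>) = ln (branching TYPE('d))"
    using \<alpha> ln_branching_pos[where ?'d = 'd] by (auto simp: B)
  have \<alpha>': "\<alpha>' \<ge> 0" using \<alpha> by simp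
  show ?thesis
    using M free_energy_tendsto_AE[OF B0 \<alpha>(1)] free_energy_tendsto_AE[OF B0 \<alpha>']
  proof eventually_elim
    case (elim \<omega>)
    have "(\<lambda>t. free_energy B (\<alpha>' * real t) t (env \<omega>) / t - ln 2 / t) \<longlonglongrightarrow> energy_density B \<alpha>' - 0"
      by (intro tendsto_diff elim lim_const_over_n)
    then have low: "\<forall>\<^sub>F t in sequentially. energy_density B \<alpha>' - r < free_energy B (\<alpha>' * real t) t (env \<omega>) / t - ln 2 / t"
      by (rule order_tendstoD) (use \<open>r > 0\<close> in simp)
    have up: "\<forall>\<^sub>F t in sequentially. free_energy B (\<alpha> * real t) t (env \<omega>) / t < energy_density B \<alpha> + r"
      using elim(2) by (rule order_tendstoD) (use \<open>r > 0\<close> in simp)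
    show ?case
      using low up eventually_hard_count_pos[OF elim(1) \<alpha>(2)]
    proof eventually_elim
      case (elim t)
      let ?N = "real (hard_count (\<alpha> * real t) t (env \<omega>))"
      have N: "?N \<ge> 1" using elim(3) by simp
      have "soft_count B (\<alpha>' * real t) t (env \<omega>) \<le> ?N + 1"
      proof (rule soft_count_le_hard_count[OF B0])
        show "real t * ln (branching TYPE('d)) \<le> B * (\<alpha>' * real t - \<alpha> * real t)"
          unfolding B_mult[symmetric] by (simp add: algebra_simps)
      qed
      also have "\<dots> \<le> 2 * ?N" using N by simp
      finally have "free_energy B (\<alpha>' * real t) t (env \<omega>) \<le> ln (2 * ?N)"
        unfolding free_energy_def using soft_count_pos by (intro ln_mono) auto
      then have "free_energy B (\<alpha>' * real t) t (env \<omega>) \<le> ln 2 + ln ?N"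
        using N by (simp add: ln_mult)
      then have "free_energy B (\<alpha>' * real t) t (env \<omega>) / t \<le> (ln 2 + ln ?N) / t"
        by (intro divide_right_mono) auto
      moreover have "ln ?N \<le> free_energy B (\<alpha> * real t) t (env \<omega>)"
        unfolding free_energy_def using N hard_count_le_soft_count by (intro ln_mono) auto
      then have "ln ?N / t \<le> free_energy B (\<alpha> * real t) t (env \<omega>) / t"
        by (intro divide_right_mono) auto
      ultimately show ?case using elim(1,2) unfolding add_divide_distrib by linarith
    qed
  qed
qed

text \<open>
  The upper and lower rates of \<open>hard_count_bounds_AE\<close> at \<open>\<alpha>' n\<close> differ by at most a multiple of
  \<open>1 / (n + 1)\<close>, by concavity between \<open>\<alpha>\<close> and a density \<open>\<gamma>\<close> with \<open>\<alpha> < \<gamma> < M\<close>, where the energy density is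
  nonnegative. Positivity is concavity between \<open>\<gamma>\<close> and \<open>0\<close>, where the energy density is positive.
\<close>
lemma hard_count_growth_AE:
  assumes M: "AE \<omega> in P. (\<lambda>t. max_fraction t \<omega>) \<longlonglongrightarrow> M" and \<alpha>: "0 \<le> \<alpha>" "\<alpha> < M"
  obtains L where "L > 0" "AE \<omega> in P. (\<lambda>t. ln (hard_count (\<alpha> * real t) t (env \<omega>)) / t) \<longlonglongrightarrow> L"
proof -
  let ?l = "ln (branching TYPE('d))"
  let ?x = "\<lambda>t \<omega>. ln (hard_count (\<alpha> * real t) t (env \<omega>)) / t"
  define \<gamma> where "\<gamma> = (\<alpha> + M) / 2"
  have \<gamma>: "\<alpha> < \<gamma>" "\<gamma> < M" "0 \<le> \<gamma>" using \<alpha> by (auto simp: \<gamma>_def)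
  \<comment> \<open>A convex combination of \<open>\<alpha>\<close> and \<open>\<gamma>\<close> that tends to \<open>\<alpha>\<close>.\<close>
  define \<alpha>' where "\<alpha>' n = (real (Suc n) * \<alpha> + \<gamma>) / real (Suc n + 1)" for n
  define B where "B n = ?l / (\<alpha>' n - \<alpha>)" for n
  have \<alpha>': "\<alpha> < \<alpha>' n" for n using \<gamma>(1) by (simp add: \<alpha>'_def field_simps)
  have B: "B n \<ge> 0" for n using \<alpha>'[of n] ln_branching_pos[where ?'d = 'd] by (simp add: B_def)
  have near: "energy_density (B n) \<alpha> - ?l / real (Suc n) \<le> energy_density (B n) (\<alpha>' n)" for n
  proof -
    define e where "e = energy_density (B n) \<alpha>"
    have e: "e \<le> ?l" unfolding e_def by (rule energy_density_le[OF B \<alpha>(1)])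
    have "e - ?l / real (Suc n) \<le> e - ?l / real (Suc n + 1)"
      using ln_branching_pos[where ?'d = 'd] by (intro diff_left_mono divide_left_mono) auto
    also have "\<dots> \<le> e - e / real (Suc n + 1)"
      using e by (intro diff_left_mono divide_right_mono) auto
    also have "\<dots> = (real (Suc n) * e) / real (Suc n + 1)"
      by (simp add: field_simps)
    also have "\<dots> \<le> (real (Suc n) * e + energy_density (B n) \<gamma>) / real (Suc n + 1)"
      using energy_density_nonneg[OF M \<gamma>(3,2) B[of n]] by (intro divide_right_mono) auto
    also have "\<dots> \<le> energy_density (B n) (\<alpha>' n)"
      unfolding e_def \<alpha>'_def by (rule energy_density_concave[OF B \<alpha>(1) \<gamma>(3)]) simp
    finally show ?thesis by (simp add: e_def)
  qed
  obtain L where L: "AE \<omega> in P. (\<lambda>t. ?x t \<omega>) \<longlonglongrightarrow> L"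
  proof (rule AE_tendsto_const_of_approx)
    fix n
    have r: "1 / real (Suc n) > 0" by simp
    have l: "?l / real (Suc n) > 0" using ln_branching_pos[where ?'d = 'd] by simp
    show "AE \<omega> in P. \<forall>\<^sub>F t in sequentially. \<bar>?x t \<omega> - energy_density (B n) \<alpha>\<bar> \<le> (?l + 1) / real (Suc n)"
      using hard_count_bounds_AE[OF M \<alpha> \<alpha>'[of n] B_def[of n] r]
    proof eventually_elim
      case (elim \<omega>)
      then show ?case
      proof eventually_elim
        case (elim t)
        then show ?case
          unfolding add_divide_distrib abs_le_iff using near[of n] l by linarith
      qed
    qed
  next
    show "(\<lambda>n. (?l + 1) / real (Suc n)) \<longlonglongrightarrow> 0"
      by (rule LIMSEQ_Suc[OF lim_const_over_n])
  qed
  have "L > 0"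
  proof -
    have "(\<lambda>n. \<gamma> - \<gamma> / real (Suc n)) \<longlonglongrightarrow> \<gamma> - 0"
      by (intro tendsto_diff tendsto_const LIMSEQ_Suc[OF lim_const_over_n])
    then have "\<forall>\<^sub>F n in sequentially. \<alpha> < \<gamma> - \<gamma> / real (Suc n)"
      by (rule order_tendstoD) (use \<gamma> in simp)
    then obtain n where n: "n \<ge> 1" "\<alpha> < \<gamma> - \<gamma> / real (Suc n)"
      using eventually_happens[OF eventually_conj[OF _ eventually_ge_at_top[of 1]]] by force
    \<comment> \<open>A convex combination of \<open>\<gamma>\<close> and \<open>0\<close> that still exceeds \<open>\<alpha>\<close>.\<close>
    define \<delta> where "\<delta> = (real n * \<gamma> + 0) / real (n + 1)"
    have \<delta>: "\<alpha> < \<delta>" using n by (simp add: \<delta>_def field_simps)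
    define C where "C = ?l / (\<delta> - \<alpha>)"
    have C: "C \<ge> 0" using \<delta> ln_branching_pos[where ?'d = 'd] by (simp add: C_def)
    define r where "r = ?l / real (n + 1) / 2"
    have r: "r > 0" using ln_branching_pos[where ?'d = 'd] by (simp add: r_def)
    have "2 * r = ?l / real (n + 1)" by (simp add: r_def field_simps)
    also have "\<dots> \<le> (real n * energy_density C \<gamma> + energy_density C 0) / real (n + 1)"
      using energy_density_nonneg[OF M \<gamma>(3,2) C] energy_density_0[OF C]
      by (intro divide_right_mono) auto
    also have "\<dots> \<le> energy_density C \<delta>"
      unfolding \<delta>_def by (rule energy_density_concave[OF C \<gamma>(3) _ n(1)]) simp
    finally have ed: "2 * r \<le> energy_density C \<delta>" .
    have "AE \<omega> in P. r \<le> L"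
      using L hard_count_bounds_AE[OF M \<alpha> \<delta> C_def r]
    proof eventually_elim
      case (elim \<omega>)
      have "\<forall>\<^sub>F t in sequentially. r \<le> ?x t \<omega>"
        using elim(2) by eventually_elim (use ed in linarith)
      then show ?case by (rule tendsto_lowerbound[OF elim(1)]) simp
    qed
    then show ?thesis using r by simp
  qed
  then show thesis using L by (rule that)
qed

end

theorem proposition5:
  fixes P :: "'w measure" and X :: "'d::finite vertex \<Rightarrow> 'w \<Rightarrow> real" and b p :: real
  assumes "CARD('d) \<ge> 4" and "b > 0" and "0 < p" and "p < 1"
    and "prob_space P"
    and "prob_space.indep_vars P (\<lambda>_. borel) X UNIV"
    and "\<And>v. measure P {\<omega> \<in> space P. X v \<omega> = exp b} = p"
    and "\<And>v. measure P {\<omega> \<in> space P. X v \<omega> = 1} = 1 - p"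
  shows "\<forall>\<alpha>. 0 \<le> \<alpha> \<and> \<alpha> < max_density P b X \<longrightarrow> growth_rate P b X \<alpha> > 1"
proof (intro allI impI, elim conjE)
  fix \<alpha> assume \<alpha>: "0 \<le> \<alpha>" "\<alpha> < max_density P b X"
  interpret percolation P "\<lambda>v \<omega>. X v \<omega> = exp b" p
    unfolding percolation_def using assms(5-7) by (rule bernoulli_field_of_indep_vars)
  obtain M where M: "AE \<omega> in P. (\<lambda>t. max_fraction t \<omega>) \<longlonglongrightarrow> M"
    by (rule max_fraction_tendsto_AE)
  have "max_density P b X = M"
    unfolding max_density_def
    by (rule as_lim_eqI[OF assms(5)]) (use M in \<open>simp add: max_fraction_def path_weight_eq_heavy\<close>)
  with \<alpha> have "\<alpha> < M" by simp
  obtain L where L: "L > 0"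
    "AE \<omega> in P. (\<lambda>t. ln (hard_count (\<alpha> * real t) t (\<lambda>v. X v \<omega> = exp b)) / t) \<longlonglongrightarrow> L"
    by (rule hard_count_growth_AE[OF M \<alpha>(1) \<open>\<alpha> < M\<close>])
  have count: "num_paths b (\<lambda>v. X v \<omega>) t \<alpha> = hard_count (\<alpha> * real t) t (\<lambda>v. X v \<omega> = exp b)" for t \<omega>
    by (simp add: num_paths_def hard_count_def path_weight_eq_heavy)
  have "growth_rate P b X \<alpha> = exp L"
    unfolding growth_rate_def count
  proof (rule as_lim_eqI[OF assms(5)])
    show "AE \<omega> in P. (\<lambda>t. real (hard_count (\<alpha> * real t) t (\<lambda>v. X v \<omega> = exp b)) powr (1 / real t)) \<longlonglongrightarrow> exp L"
      using L(2) M
    proof eventually_elim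
      case (elim \<omega>)
      have "\<forall>\<^sub>F t in sequentially. exp (ln (hard_count (\<alpha> * real t) t (\<lambda>v. X v \<omega> = exp b)) / t)
          = real (hard_count (\<alpha> * real t) t (\<lambda>v. X v \<omega> = exp b)) powr (1 / real t)"
        using eventually_hard_count_pos[OF elim(2) \<open>\<alpha> < M\<close>]
        by (auto elim!: eventually_mono simp: powr_def)
      then show ?case
        by (rule Lim_transform_eventually[OF tendsto_exp[OF elim(1)]])
    qed
  qed
  then show "growth_rate P b X \<alpha> > 1" using L(1) by simp
qed

end
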